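(* Let $u:\mathbb{R}^2\setminus\{(0,0)\}\to\mathbb{R}$ be a $\mathcal{C}^2$ solution of $u_{xx}u_{yy}-u_{xy}^2=0$ with an isolated singularity at the origin. Then one of the following holds: (1) $u$ is a conical function in $\mathbb{R}^2\setminus\{(0,0)\}$ (with vertex at the origin); or (2) there exists a line $r$ containing the origin such that $u$ is a cylindrical function in one of the two open half-planes determined by $r$, and $u$ is a conical function with vertex at the origin in the other open half-plane.
   Context: "$u$ has an isolated singularity at the origin" means that $u$ cannot be extended to the origin as a $\mathcal{C}^2$ function. An open strip is a region $\{xe_1+ye_2: x\in I,\ y\in\mathbb{R}\}$, where $\{e_1,e_2\}$ is an orthonormal basis of $\mathbb{R}^2$ and $I\subseteq\mathbb{R}$ is a nonempty open interval, possibly unbounded (so open half-planes and $\mathbb{R}^2$ are included). A function $u$ is cylindrical in this strip if there are a $\mathcal{C}^2$ function $\alpha:I\to\mathbb{R}$ and a constant $v_0\in\mathbb{R}$ with $u(xe_1+ye_2)=\alpha(x)+v_0\,y$ for all $x\in I$, $y\in\mathbb{R}$. A function $u$ is conical with vertex $p$ in an open sector $\{p+\rho(\cos\theta,\sin\theta):\rho>0,\ \theta_1<\theta<\theta_2\}$, $0<\theta_2-\theta_1<2\pi$ (an open half-plane whose boundary contains $p$ is such a sector), or in $\mathbb{R}^2\setminus\{p\}$, if there are a constant $u_0\in\mathbb{R}$ and a $\mathcal{C}^2$ function $\alpha(\theta)$ ($2\pi$-periodic in the case of $\mathbb{R}^2\setminus\{p\}$) with $u(p+\rho(\cos\theta,\sin\theta))=u_0+\rho\,\alpha(\theta)$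 on that domain. *)

theory Defs
  imports "HOL-Analysis.Analysis"
begin

text \<open>Functions on subsets of the plane are total functions on \<^typ>\<open>real \<times> real\<close>; their values
  off the set in question are irrelevant.\<close>

(* Meant for open S: the derivatives are taken in the full space (at x), not within S. *)
definition C2_on :: "('a::euclidean_space \<Rightarrow> real) \<Rightarrow> 'a set \<Rightarrow> bool" where
  "C2_on f S \<longleftrightarrow>
    (\<exists>(f' :: 'a \<Rightarrow> 'a \<Rightarrow>\<^sub>L real) (f'' :: 'a \<Rightarrow> 'a \<Rightarrow>\<^sub>L 'a \<Rightarrow>\<^sub>L real).
      (\<forall>x\<in>S. (f has_derivative blinfun_apply (f' x)) (at x)) \<and>
      (\<forall>x\<in>S. (f' has_derivative blinfun_apply (f'' x)) (at x)) \<and>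
      continuous_on S f'')"

definition partial_deriv :: "'a::euclidean_space \<Rightarrow> ('a \<Rightarrow> real) \<Rightarrow> 'a \<Rightarrow> real" where
  "partial_deriv b f p = deriv (\<lambda>t. f (p + t *\<^sub>R b)) 0"

abbreviation D\<^sub>x :: "(real \<times> real \<Rightarrow> real) \<Rightarrow> real \<times> real \<Rightarrow> real" where
  "D\<^sub>x \<equiv> partial_deriv (1, 0)"

abbreviation D\<^sub>y :: "(real \<times> real \<Rightarrow> real) \<Rightarrow> real \<times> real \<Rightarrow> real" where
  "D\<^sub>y \<equiv> partial_deriv (0, 1)"

definition hessian_det :: "(real \<times> real \<Rightarrow> real) \<Rightarrow> real \<times> real \<Rightarrow> real" where
  "hessian_det u p = D\<^sub>x (D\<^sub>x u) p * D\<^sub>y (D\<^sub>y u) p - (D\<^sub>y (D\<^sub>x u) p)\<^sup>2"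

definition isolated_singularity_at_origin :: "(real \<times> real \<Rightarrow> real) \<Rightarrow> bool" where
  "isolated_singularity_at_origin u \<longleftrightarrow>
    \<not> (\<exists>v. C2_on v UNIV \<and> (\<forall>p. p \<noteq> (0, 0) \<longrightarrow> v p = u p))"

definition strip :: "real \<times> real \<Rightarrow> real \<times> real \<Rightarrow> real set \<Rightarrow> (real \<times> real) set" where
  "strip e1 e2 I = {x *\<^sub>R e1 + y *\<^sub>R e2 | x y. x \<in> I}"

definition cylindrical_on :: "(real \<times> real \<Rightarrow> real) \<Rightarrow> (real \<times> real) set \<Rightarrow> bool" where
  "cylindrical_on u S \<longleftrightarrow>
    (\<exists>e1 e2 I \<alpha> v0.
      norm e1 = 1 \<and> norm e2 = 1 \<and> e1 \<bullet> e2 = 0 \<and>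
      open I \<and> is_interval I \<and> I \<noteq> {} \<and> S = strip e1 e2 I \<and>
      C2_on \<alpha> I \<and>
      (\<forall>x\<in>I. \<forall>y. u (x *\<^sub>R e1 + y *\<^sub>R e2) = \<alpha> x + v0 * y))"

definition sector :: "real \<times> real \<Rightarrow> real \<Rightarrow> real \<Rightarrow> (real \<times> real) set" where
  "sector p \<theta>\<^sub>1 \<theta>\<^sub>2 =
    {p + \<rho> *\<^sub>R (cos \<theta>, sin \<theta>) | \<rho> \<theta>. 0 < \<rho> \<and> \<theta>\<^sub>1 < \<theta> \<and> \<theta> < \<theta>\<^sub>2}"

definition conical_on ::
  "(real \<times> real \<Rightarrow> real) \<Rightarrow> real \<times> real \<Rightarrow> (real \<times> real) set \<Rightarrow> bool" where
  "conical_on u p S \<longleftrightarrow>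
    (\<exists>\<theta>\<^sub>1 \<theta>\<^sub>2 u0 \<alpha>.
      0 < \<theta>\<^sub>2 - \<theta>\<^sub>1 \<and> \<theta>\<^sub>2 - \<theta>\<^sub>1 < 2 * pi \<and> S = sector p \<theta>\<^sub>1 \<theta>\<^sub>2 \<and>
      C2_on \<alpha> {\<theta>\<^sub>1<..<\<theta>\<^sub>2} \<and>
      (\<forall>\<rho>>0. \<forall>\<theta>\<in>{\<theta>\<^sub>1<..<\<theta>\<^sub>2}. u (p + \<rho> *\<^sub>R (cos \<theta>, sin \<theta>)) = u0 + \<rho> * \<alpha> \<theta>)) \<or>
    (S = UNIV - {p} \<and>
      (\<exists>u0 \<alpha>. C2_on \<alpha> UNIV \<and> (\<forall>\<theta>. \<alpha> (\<theta> + 2 * pi) = \<alpha> \<theta>) \<and>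
        (\<forall>\<rho>>0. \<forall>\<theta>. u (p + \<rho> *\<^sub>R (cos \<theta>, sin \<theta>)) = u0 + \<rho> * \<alpha> \<theta>)))"

definition is_line :: "(real \<times> real) set \<Rightarrow> bool" where
  "is_line r \<longleftrightarrow> affine r \<and> aff_dim r = 1"

(* A and B are the two sides of r, in either order, as n may be replaced by -n. *)
definition open_half_planes ::
  "(real \<times> real) set \<Rightarrow> (real \<times> real) set \<Rightarrow> (real \<times> real) set \<Rightarrow> bool" where
  "open_half_planes r A B \<longleftrightarrow>
    (\<exists>n c. n \<noteq> 0 \<and> r = {p. n \<bullet> p = c} \<and> A = {p. n \<bullet> p > c} \<and> B = {p. n \<bullet> p < c})"

end

theory Submission
  imports Defs
begin

text \<open>At a point where the Hessian is nonzero its kernel is a line, and (Hartman--Nirenberg) the Hessian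
  stays nonzero with the same kernel direction along this line as long as the origin is not met.
  Such kernel lines cannot cross. If they all point to the origin, the Hessian annihilates the
  radial direction everywhere and \<open>u\<close> is conical. Otherwise some kernel line, with direction \<open>v\<close>, misses
  the origin; in the half-plane bounded by the parallel line through the origin every other kernel
  line would cross it unless parallel, so the Hessian annihilates \<open>v\<close> there and \<open>u\<close> is cylindrical. In the
  opposite half-plane the kernel lines are either all radial, or all parallel to \<open>v\<close>; in the latter
  case \<open>u\<close> is cylindrical off the origin and therefore extends to it as a \<open>C\<^sup>2\<close> function.\<close>

section \<open>Symmetry of the second derivative\<close>

lemma has_real_derivative_along_curve:
  fixes f :: "'a::real_normed_vector \<Rightarrow> real"
  assumes f: "(f has_derivative f') (at (c t))" and c: "(c has_vector_derivative a) (at t)"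
  shows "((\<lambda>t. f (c t)) has_real_derivative f' a) (at t)"
proof -
  interpret f': bounded_linear f' using f by (rule has_derivative_bounded_linear)
  show ?thesis
    using has_derivative_compose[OF c[unfolded has_vector_derivative_def] f]
    by (simp add: has_field_derivative_def f'.scaleR mult.commute[of _ "f' a"])
qed

text \<open>The mean value theorem is applied twice, first along \<open>a\<close> to the difference
  of two parallel slices, then along \<open>b\<close> to the slope \<open>f' _ a\<close>. The second
  difference is symmetric in \<open>a\<close> and \<open>b\<close>, but the order of the two
  applications decides which mixed derivative appears; \<open>second_derivative_symmetric\<close>
  exploits this.\<close>

lemma second_difference_mean_value:
  fixes f :: "'a::real_normed_vector \<Rightarrow> real"
    and f' :: "'a \<Rightarrow> 'a \<Rightarrow>\<^sub>L real" and f'' :: "'a \<Rightarrow> 'a \<Rightarrow>\<^sub>L 'a \<Rightarrow>\<^sub>L real"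
  assumes "h > 0"
    and S: "\<And>s t. \<lbrakk>0 \<le> s; s \<le> h; 0 \<le> t; t \<le> h\<rbrakk> \<Longrightarrow> z + s *\<^sub>R a + t *\<^sub>R b \<in> S"
    and f': "\<And>x. x \<in> S \<Longrightarrow> (f has_derivative f' x) (at x)"
    and f'': "\<And>x. x \<in> S \<Longrightarrow> (f' has_derivative f'' x) (at x)"
  shows "\<exists>s t. 0 < s \<and> s < h \<and> 0 < t \<and> t < h \<and>
    f (z + h *\<^sub>R a + h *\<^sub>R b) - f (z + h *\<^sub>R a) - (f (z + h *\<^sub>R b) - f z)
      = h * (h * f'' (z + s *\<^sub>R a + t *\<^sub>R b) b a)"
proof -
  \<comment> \<open>The vacuous summand \<open>0 *\<^sub>R b\<close> gives both terms the shape
    covered by the hypothesis \<open>S\<close>.\<close>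
  define g where "g = (\<lambda>s. f (z + s *\<^sub>R a + h *\<^sub>R b) - f (z + s *\<^sub>R a + 0 *\<^sub>R b))"
  have "(g has_real_derivative f' (z + s *\<^sub>R a + h *\<^sub>R b) a - f' (z + s *\<^sub>R a + 0 *\<^sub>R b) a) (at s)"
    if "0 \<le> s" "s \<le> h" for s
    unfolding g_def
    using that \<open>h > 0\<close>
    by (intro DERIV_diff has_real_derivative_along_curve[OF f'] S) (auto intro!: derivative_eq_intros)
  from MVT2[OF \<open>h > 0\<close> this] obtain s where s: "0 < s" "s < h"
    "g h - g 0 = (h - 0) * (f' (z + s *\<^sub>R a + h *\<^sub>R b) a - f' (z + s *\<^sub>R a + 0 *\<^sub>R b) a)"
    by blast
  have "((\<lambda>t. f' (z + s *\<^sub>R a + t *\<^sub>R b) a) has_real_derivative f'' (z + s *\<^sub>R a + t *\<^sub>R b) b a) (at t)"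
    if "0 \<le> t" "t \<le> h" for t
  proof (rule has_real_derivative_along_curve[where f="\<lambda>x. f' x a"
        and f'="\<lambda>h. f'' (z + s *\<^sub>R a + t *\<^sub>R b) h a"])
    show "((\<lambda>x. f' x a) has_derivative (\<lambda>h. f'' (z + s *\<^sub>R a + t *\<^sub>R b) h a)) (at (z + s *\<^sub>R a + t *\<^sub>R b))"
      using that s by (auto intro!: derivative_eq_intros f'' S simp: blinfun.bilinear_simps)
  qed (auto intro!: derivative_eq_intros)
  from MVT2[OF \<open>h > 0\<close> this] obtain t where t: "0 < t" "t < h"
    "f' (z + s *\<^sub>R a + h *\<^sub>R b) a - f' (z + s *\<^sub>R a + 0 *\<^sub>R b) a
      = (h - 0) * f'' (z + s *\<^sub>R a + t *\<^sub>R b) b a"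
    by blast
  show ?thesis
    using s t unfolding g_def by (intro exI[of _ s] exI[of _ t]) simp
qed

lemma second_derivative_symmetric:
  fixes f :: "'a::real_normed_vector \<Rightarrow> real"
    and f' :: "'a \<Rightarrow> 'a \<Rightarrow>\<^sub>L real" and f'' :: "'a \<Rightarrow> 'a \<Rightarrow>\<^sub>L 'a \<Rightarrow>\<^sub>L real"
  assumes "open S" "z \<in> S"
    and f': "\<And>x. x \<in> S \<Longrightarrow> (f has_derivative f' x) (at x)"
    and f'': "\<And>x. x \<in> S \<Longrightarrow> (f' has_derivative f'' x) (at x)"
    and cont: "continuous_on S f''"
  shows "f'' z a b = f'' z b a"
proof -
  have near: "\<exists>d>0. \<forall>x. dist x z < d \<longrightarrow> x \<in> S \<and> \<bar>f'' x v w - f'' z v w\<bar> < e" if "e > 0" for e v w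
  proof -
    have "continuous_on S (\<lambda>x. f'' x v w)"
      by (intro continuous_intros cont)
    then have "open (S \<inter> (\<lambda>x. f'' x v w) -` ball (f'' z v w) e)"
      by (intro continuous_open_preimage \<open>open S\<close>) auto
    moreover have "z \<in> S \<inter> (\<lambda>x. f'' x v w) -` ball (f'' z v w) e"
      using \<open>z \<in> S\<close> that by auto
    ultimately show ?thesis
      unfolding open_dist by (force simp: dist_real_def abs_minus_commute)
  qed
  have "\<bar>f'' z a b - f'' z b a\<bar> \<le> e" if "e > 0" for e
  proof -
    obtain d1 where d1: "d1 > 0" "\<And>x. dist x z < d1 \<Longrightarrow> x \<in> S \<and> \<bar>f'' x a b - f'' z a b\<bar> < e / 2"
      using near[of "e / 2" a b] \<open>e > 0\<close> by auto
    obtain d2 where d2: "d2 > 0" "\<And>x. dist x z < d2 \<Longrightarrow> x \<in> S \<and> \<bar>f'' x b a - f'' z b a\<bar> < e / 2"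
      using near[of "e / 2" b a] \<open>e > 0\<close> by auto
    define d where "d = min d1 d2"
    \<comment> \<open>Chosen so that the whole parallelogram with sides \<open>h a\<close> and
      \<open>h b\<close> at \<open>z\<close> lies within distance \<open>d\<close> of
      \<open>z\<close>. The summand 1 keeps the denominator positive, the factor 2 makes the bound
      strict.\<close>
    define h where "h = d / (2 * (norm a + norm b + 1))"
    have pos: "norm a + norm b + 1 > 0"
      by (smt (verit) norm_ge_zero)
    have "d > 0" using d1 d2 by (simp add: d_def)
    then have "h > 0" using pos by (simp add: h_def)
    have small: "dist (z + s *\<^sub>R v + t *\<^sub>R w) z < d"
      if "0 \<le> s" "s \<le> h" "0 \<le> t" "t \<le> h" "v = a \<and> w = b \<or> v = b \<and> w = a" for s t v w
    proof -
      have "dist (z + s *\<^sub>R v + t *\<^sub>R w) z = norm (s *\<^sub>R v + t *\<^sub>R w)"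
        by (simp add: dist_norm algebra_simps)
      also have "\<dots> \<le> s * norm v + t * norm w"
        using norm_triangle_ineq[of "s *\<^sub>R v" "t *\<^sub>R w"] that by simp
      also have "\<dots> \<le> h * norm v + h * norm w"
        using that by (intro add_mono mult_right_mono) auto
      also have "\<dots> \<le> h * (norm a + norm b + 1)"
        using that \<open>h > 0\<close> by (auto simp: algebra_simps)
      also have "\<dots> < d"
        using pos \<open>d > 0\<close> by (simp add: h_def pos_divide_less_eq)
      finally show ?thesis .
    qed
    obtain s t where st: "0 < s" "s < h" "0 < t" "t < h"
      "f (z + h *\<^sub>R a + h *\<^sub>R b) - f (z + h *\<^sub>R a) - (f (z + h *\<^sub>R b) - f z)
        = h * (h * f'' (z + s *\<^sub>R a + t *\<^sub>R b) b a)"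
      using second_difference_mean_value[OF \<open>h > 0\<close> _ f' f'', of z a b S] small d1 d_def by force
    obtain s' t' where st': "0 < s'" "s' < h" "0 < t'" "t' < h"
      "f (z + h *\<^sub>R b + h *\<^sub>R a) - f (z + h *\<^sub>R b) - (f (z + h *\<^sub>R a) - f z)
        = h * (h * f'' (z + s' *\<^sub>R b + t' *\<^sub>R a) a b)"
      using second_difference_mean_value[OF \<open>h > 0\<close> _ f' f'', of z b a S] small d1 d_def by force
    \<comment> \<open>Both second differences are the same number, so the two mixed derivatives
      agree at two possibly different points near \<open>z\<close>.\<close>
    have "z + h *\<^sub>R b + h *\<^sub>R a = z + h *\<^sub>R a + h *\<^sub>R b"
      by (simp add: algebra_simps)
    from st(5) st'(5)[unfolded this] have "h * (h * f'' (z + s *\<^sub>R a + t *\<^sub>R b) b a) = h * (h * f'' (z + s' *\<^sub>R b + t' *\<^sub>R a) a b)"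
      by linarith
    then have eq: "f'' (z + s *\<^sub>R a + t *\<^sub>R b) b a = f'' (z + s' *\<^sub>R b + t' *\<^sub>R a) a b"
      using \<open>h > 0\<close> by simp
    have "\<bar>f'' (z + s *\<^sub>R a + t *\<^sub>R b) b a - f'' z b a\<bar> < e / 2"
      using small[of s t a b] st d2(2) by (force simp: d_def)
    moreover have "\<bar>f'' (z + s' *\<^sub>R b + t' *\<^sub>R a) a b - f'' z a b\<bar> < e / 2"
      using small[of s' t' b a] st' d1(2) by (force simp: d_def)
    ultimately show ?thesis using eq by linarith
  qed
  then show ?thesis
    by (metis abs_le_zero_iff eq_iff_diff_eq_0 field_le_epsilon add_0)
qed

section \<open>Kernel lines of a degenerate Hessian\<close>

text \<open>In the coordinates \<open>(c, t) = (p, t)\<close> near the base point, \<open>q\<close> depends on \<open>c\<close> alone, and the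
  symmetry \<open>p\<^sub>t = q\<^sub>x\<close> turns \<open>\<partial>x/\<partial>t = - p\<^sub>t/p\<^sub>x\<close> into \<open>- \<partial>q/\<partial>c\<close>, which is then
  independent of \<open>t\<close>. So \<open>x(c, t)\<close> is affine in \<open>t\<close>, and hence so is \<open>\<partial>x/\<partial>c = 1/p\<^sub>x\<close>.\<close>

lemma local_kernel_line:
  fixes p q px py qy :: "real \<times> real \<Rightarrow> real"
  assumes "open S" "(x0, t0) \<in> S"
    and p: "\<And>z. z \<in> S \<Longrightarrow> (p has_derivative (\<lambda>h. px z * fst h + py z * snd h)) (at z)"
    and q: "\<And>z. z \<in> S \<Longrightarrow> (q has_derivative (\<lambda>h. py z * fst h + qy z * snd h)) (at z)"
    and cont: "continuous_on S px" "continuous_on S py"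
    and det: "\<And>z. z \<in> S \<Longrightarrow> px z * qy z = (py z)\<^sup>2"
    and px0: "px (x0, t0) \<noteq> 0" and py0: "py (x0, t0) = 0"
  shows "\<exists>\<delta>>0. \<exists>a b. \<forall>t. \<bar>t - t0\<bar> < \<delta> \<longrightarrow> py (x0, t) = 0 \<and> px (x0, t) * (a + b * t) = 1"
proof -
  \<comment> \<open>Where \<open>px\<close> is nonzero, \<open>F\<close> below is a local change of
    coordinates from \<open>(x, t)\<close> to \<open>(c, t)\<close>; its inverse is
    \<open>g\<close>.\<close>
  define S' where "S' = S \<inter> px -` (- {0})"
  have "open S'"
    unfolding S'_def using cont(1) \<open>open S\<close> by (intro continuous_open_preimage) auto
  have z0: "(x0, t0) \<in> S'" using assms by (simp add: S'_def)
  have S'D: "z \<in> S" "px z \<noteq> 0" if "z \<in> S'" for z using that by (auto simp: S'_def)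
  define F where "F = (\<lambda>z. (p z, snd z))"
  \<comment> \<open>Matrix units from which the derivative of \<open>F\<close> is assembled, so that
    its continuity in operator norm reduces to that of \<open>px\<close> and
    \<open>py\<close>.\<close>
  define E1 E2 E3 :: "(real \<times> real) \<Rightarrow>\<^sub>L (real \<times> real)" where
    "E1 = Blinfun (\<lambda>h. (fst h, 0))" and "E2 = Blinfun (\<lambda>h. (snd h, 0))" and "E3 = Blinfun (\<lambda>h. (0, snd h))"
  have E: "E1 h = (fst h, 0)" "E2 h = (snd h, 0)" "E3 h = (0, snd h)" for h
    unfolding E1_def E2_def E3_def
    by (subst bounded_linear_Blinfun_apply; auto intro!: bounded_linear_intros)+
  define F' where "F' = (\<lambda>z. px z *\<^sub>R E1 + py z *\<^sub>R E2 + E3)"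
  have F'_apply: "F' z h = (px z * fst h + py z * snd h, snd h)" for z h
    by (simp add: F'_def blinfun.bilinear_simps E)
  have "(F has_derivative F' z) (at z)" if "z \<in> S'" for z
    unfolding F_def F'_apply[abs_def]
    by (auto intro!: derivative_eq_intros p S'D that)
  moreover have "continuous_on S' F'"
    unfolding F'_def by (intro continuous_intros continuous_on_subset[OF cont(1)]
        continuous_on_subset[OF cont(2)]) (auto simp: S'_def)
  \<comment> \<open>Since \<open>py\<close> vanishes at the base point, the derivative of
    \<open>F\<close> is diagonal there and its inverse is explicit.\<close>
  moreover have "(inverse (px (x0, t0)) *\<^sub>R E1 + E3) o\<^sub>L F' (x0, t0) = id_blinfun"
    by (rule blinfun_eqI) (simp add: F'_apply blinfun.bilinear_simps E px0 py0 prod_eq_iff)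
  ultimately obtain U V g g' where "open U" "U \<subseteq> S'" "(x0, t0) \<in> U" "open V" "F (x0, t0) \<in> V"
    and hom: "homeomorphism U V F g"
    and g: "\<And>y. y \<in> V \<Longrightarrow> (g has_derivative g' y) (at y)"
    and g': "\<And>y. y \<in> V \<Longrightarrow> g' y = inv (F' (g y))"
    and bij: "\<And>y. y \<in> V \<Longrightarrow> bij (F' (g y))"
    using inverse_function_theorem[OF \<open>open S'\<close> _ _ z0] by metis
  define c0 where "c0 = p (x0, t0)"
  have gS: "g w \<in> S'" if "w \<in> V" for w
    using hom that \<open>U \<subseteq> S'\<close> unfolding homeomorphism_def by auto
  have Fg: "F (g w) = w" if "w \<in> V" for w
    using hom that unfolding homeomorphism_def by auto
  have g0: "g (c0, t0) = (x0, t0)"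
    using hom \<open>(x0, t0) \<in> U\<close> unfolding homeomorphism_def c0_def F_def by auto
  have snd_g: "snd (g w) = snd w" if "w \<in> V" for w
    using Fg[OF that] by (cases w) (simp add: F_def)
  have F'g': "F' (g w) (g' w h) = h" if "w \<in> V" for w h
    using bij[OF that] g'[OF that] by (simp add: bij_is_surj surj_f_inv_f)
  have snd_g': "snd (g' w h) = snd h" if "w \<in> V" for w h
    using F'g'[OF that, of h] by (cases h) (auto simp: F'_apply)
  have fst_g': "fst (g' w h) = (fst h - py (g w) * snd h) / px (g w)" if "w \<in> V" for w h
    using F'g'[OF that, of h] snd_g'[OF that, of h] S'D(2)[OF gS[OF that]]
    by (cases h) (auto simp: F'_apply field_simps)
  \<comment> \<open>A product neighbourhood allows moving in \<open>t\<close> with \<open>c\<close>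
    fixed, and in \<open>c\<close> with \<open>t\<close> fixed, without leaving
    \<open>V\<close>.\<close>
  obtain A B where AB: "open A" "open B" "c0 \<in> A" "t0 \<in> B" "A \<times> B \<subseteq> V"
    using \<open>open V\<close> \<open>F (x0, t0) \<in> V\<close> unfolding c0_def F_def by (auto elim!: open_prod_elim)
  obtain \<delta> where "\<delta> > 0" and \<delta>: "ball t0 \<delta> \<subseteq> B"
    using AB(2,4) open_contains_ball by blast
  define J where "J = ball t0 \<delta>"
  have inV: "(c, t) \<in> V" if "c \<in> A" "t \<in> J" for c t
    using that AB \<delta> J_def by auto
  have J: "open J" "connected J" "t0 \<in> J" using \<open>\<delta> > 0\<close> by (auto simp: J_def)
  have g_vert: "((\<lambda>t. g (c, t)) has_derivative (\<lambda>h. g' (c, s) (0, h))) (at s)" if "(c, s) \<in> V" for c s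
    by (rule has_derivative_compose[where f="\<lambda>t. (c, t)", OF _ g[OF that]]) (auto intro!: derivative_eq_intros)
  have g_hor: "((\<lambda>c. g (c, t)) has_derivative (\<lambda>h. g' (c, t) (h, 0))) (at c)" if "(c, t) \<in> V" for c t
    by (rule has_derivative_compose[where f="\<lambda>c. (c, t)", OF _ g[OF that]]) (auto intro!: derivative_eq_intros)
  \<comment> \<open>Along a level curve of \<open>p\<close> the derivative of \<open>q\<close> is
    \<open>qy - py^2 / px\<close>, which \<open>det\<close> makes zero.\<close>
  have q_const: "q (g (c, t)) = q (g (c, t0))" if "c \<in> A" "t \<in> J" for c t
  proof (rule has_derivative_zero_unique_connected[OF J(1,2), where f="\<lambda>t. q (g (c, t))"])
    fix s assume "s \<in> J"
    then have w: "(c, s) \<in> V" using that inV by auto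
    have "((\<lambda>t. q (g (c, t))) has_derivative
        (\<lambda>h. py (g (c, s)) * fst (g' (c, s) (0, h)) + qy (g (c, s)) * snd (g' (c, s) (0, h)))) (at s)"
      by (rule has_derivative_compose[OF g_vert[OF w] q[OF S'D(1)[OF gS[OF w]]]])
    moreover have "py (g (c, s)) * fst (g' (c, s) (0, h)) + qy (g (c, s)) * snd (g' (c, s) (0, h)) = 0" for h
      using det[OF S'D(1)[OF gS[OF w]]] S'D(2)[OF gS[OF w]]
      by (simp add: fst_g'[OF w] snd_g'[OF w] field_simps power2_eq_square)
    ultimately show "((\<lambda>t. q (g (c, t))) has_derivative (\<lambda>h. 0)) (at s)" by simp
  qed (use J that in auto)
  have slope: "py (g (c, t)) / px (g (c, t)) = py (g (c, t0)) / px (g (c, t0))"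
    if "c \<in> A" "t \<in> J" for c t
  proof -
    \<comment> \<open>The quotient \<open>py / px\<close> is the \<open>c\<close>-derivative of
      \<open>q\<close>, and as a function of \<open>c\<close> that \<open>q\<close> is the same for
      all \<open>t\<close>.\<close>
    have D: "((\<lambda>c. q (g (c, t))) has_real_derivative py (g (c, t)) / px (g (c, t))) (at c)" if "t \<in> J" for t
    proof -
      have w: "(c, t) \<in> V" using that \<open>c \<in> A\<close> inV by auto
      have "((\<lambda>c. q (g (c, t))) has_derivative
          (\<lambda>h. py (g (c, t)) * fst (g' (c, t) (h, 0)) + qy (g (c, t)) * snd (g' (c, t) (h, 0)))) (at c)"
        by (rule has_derivative_compose[OF g_hor[OF w] q[OF S'D(1)[OF gS[OF w]]]])
      then show ?thesis
        by (rule has_derivative_imp_has_field_derivative) (simp add: fst_g'[OF w] snd_g'[OF w])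
    qed
    have "((\<lambda>c. q (g (c, t0))) has_real_derivative py (g (c, t)) / px (g (c, t))) (at c)"
      using q_const[OF _ \<open>t \<in> J\<close>]
      by (intro has_field_derivative_transform_within_open[OF D[OF \<open>t \<in> J\<close>] \<open>open A\<close> \<open>c \<in> A\<close>]) auto
    then show ?thesis using D[OF J(3)] DERIV_unique by blast
  qed
  have straight: "fst (g (c, t)) = fst (g (c, t0)) - py (g (c, t0)) / px (g (c, t0)) * (t - t0)"
    if "c \<in> A" "t \<in> J" for c t
  proof -
    let ?m = "py (g (c, t0)) / px (g (c, t0))"
    have "fst (g (c, t)) + ?m * t = fst (g (c, t0)) + ?m * t0"
    proof (rule has_derivative_zero_unique_connected[OF J(1,2), where f="\<lambda>t. fst (g (c, t)) + ?m * t"])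
      fix s assume "s \<in> J"
      then have w: "(c, s) \<in> V" using that inV by auto
      have "((\<lambda>t. fst (g (c, t)) + ?m * t) has_derivative (\<lambda>h. fst (g' (c, s) (0, h)) + ?m * h)) (at s)"
        by (intro derivative_intros g_vert w)
      moreover have "fst (g' (c, s) (0, h)) + ?m * h = 0" for h
        using arg_cong[OF slope[OF \<open>c \<in> A\<close> \<open>s \<in> J\<close>], of "\<lambda>m. m * h"] by (simp add: fst_g'[OF w])
      ultimately show "((\<lambda>t. fst (g (c, t)) + ?m * t) has_derivative (\<lambda>h. 0)) (at s)" by simp
    qed (use J that in auto)
    then show ?thesis by (simp add: algebra_simps diff_divide_distrib)
  qed
  \<comment> \<open>The level curve through the base point has slope \<open>py / px = 0\<close>, so
    it is the vertical line itself.\<close>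
  have g_line: "g (c0, t) = (x0, t)" if "t \<in> J" for t
    using straight[OF \<open>c0 \<in> A\<close> that] snd_g[OF inV[OF \<open>c0 \<in> A\<close> that]] g0 py0
    by (cases "g (c0, t)") simp
  have line_S: "(x0, t) \<in> S'" if "t \<in> J" for t
    using gS[OF inV[OF \<open>c0 \<in> A\<close> that]] g_line[OF that] by simp
  define t1 where "t1 = t0 + \<delta> / 2"
  have t1: "t1 \<in> J" using \<open>\<delta> > 0\<close> by (simp add: t1_def J_def dist_real_def)
  have dX: "((\<lambda>c. fst (g (c, t))) has_real_derivative 1 / px (x0, t)) (at c0)" if "t \<in> J" for t
  proof -
    have w: "(c0, t) \<in> V" using that AB inV by auto
    have "((\<lambda>c. fst (g (c, t))) has_derivative (\<lambda>h. fst (g' (c0, t) (h, 0)))) (at c0)"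
      by (intro derivative_intros g_hor w)
    then show ?thesis
      by (rule has_derivative_imp_has_field_derivative) (simp add: fst_g'[OF w] g_line[OF that])
  qed
  \<comment> \<open>\<open>a + b * t\<close> is the affine interpolation of \<open>1 / px\<close>
    between the parameters \<open>t0\<close> and \<open>t1\<close>.\<close>
  define b where "b = (1 / px (x0, t1) - 1 / px (x0, t0)) / (\<delta> / 2)"
  define a where "a = 1 / px (x0, t0) - b * t0"
  have "1 / px (x0, t) = a + b * t" if "t \<in> J" for t
  proof -
    let ?l = "(t - t0) / (\<delta> / 2)"
    \<comment> \<open>For every \<open>c\<close> near \<open>c0\<close> the position is affine in
      \<open>t\<close>, so its value at \<open>t\<close> is a combination of those at
      \<open>t0\<close> and \<open>t1\<close> with weights free of \<open>c\<close>. Differentiating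
      in \<open>c\<close> transfers this combination to \<open>1 / px\<close>.\<close>
    have interp: "fst (g (c, t0)) + ?l * (fst (g (c, t1)) - fst (g (c, t0))) = fst (g (c, t))" if "c \<in> A" for c
    proof -
      define m where "m = py (g (c, t0)) / px (g (c, t0))"
      have "fst (g (c, t1)) - fst (g (c, t0)) = - m * (\<delta> / 2)"
        using straight[OF that t1] unfolding m_def[symmetric] by (simp add: t1_def)
      moreover have "fst (g (c, t)) = fst (g (c, t0)) - m * (t - t0)"
        using straight[OF that \<open>t \<in> J\<close>] unfolding m_def[symmetric] .
      ultimately show ?thesis using \<open>\<delta> > 0\<close> by simp
    qed
    have "((\<lambda>c. fst (g (c, t0)) + ?l * (fst (g (c, t1)) - fst (g (c, t0)))) has_real_derivative
        1 / px (x0, t0) + ?l * (1 / px (x0, t1) - 1 / px (x0, t0))) (at c0)"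
      using \<open>\<delta> > 0\<close> by (intro DERIV_add DERIV_cmult DERIV_diff dX J t1)
    then have "((\<lambda>c. fst (g (c, t))) has_real_derivative
        1 / px (x0, t0) + ?l * (1 / px (x0, t1) - 1 / px (x0, t0))) (at c0)"
      by (rule has_field_derivative_transform_within_open[OF _ \<open>open A\<close> \<open>c0 \<in> A\<close> interp])
    with dX[OF that] have "1 / px (x0, t) = 1 / px (x0, t0) + ?l * (1 / px (x0, t1) - 1 / px (x0, t0))"
      using DERIV_unique by blast
    also have "?l * (1 / px (x0, t1) - 1 / px (x0, t0)) = (t - t0) * b"
      by (simp only: b_def times_divide_eq_left times_divide_eq_right)
    finally show ?thesis by (simp add: a_def algebra_simps)
  qed
  moreover have "py (x0, t) = 0" if "t \<in> J" for t
    using slope[OF \<open>c0 \<in> A\<close> that] g_line[OF that] g0 py0 S'D(2)[OF line_S[OF that]] by simp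
  moreover have "t \<in> J" if "\<bar>t - t0\<bar> < \<delta>" for t
    using that by (simp add: J_def dist_real_def abs_minus_commute)
  ultimately show ?thesis
    using \<open>\<delta> > 0\<close> S'D(2)[OF line_S]
    by (intro exI[of _ \<delta>] conjI exI[of _ a] exI[of _ b]) (auto simp flip: \<open>\<And>t. t \<in> J \<Longrightarrow> 1 / px (x0, t) = a + b * t\<close>)
qed

section \<open>Linear algebra of degenerate symmetric forms in the plane\<close>

abbreviation perp :: "real \<times> real \<Rightarrow> real \<times> real" where
  "perp v \<equiv> (- snd v, fst v)"

text \<open>\<open>perp v \<bullet> w\<close> is the determinant of \<open>v\<close> and
  \<open>w\<close>. Besides testing parallelism, for nonzero \<open>v\<close> it labels the lines of
  direction \<open>v\<close>, with level 0 for the one through the origin.\<close>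

lemma perp_orthogonal_imp_parallel:
  assumes "v \<noteq> 0" "perp v \<bullet> w = 0"
  obtains k where "w = k *\<^sub>R v"
proof -
  obtain a b c d :: real where [simp]: "v = (a, b)" "w = (c, d)" by (metis surj_pair)
  have eq: "a * d = b * c" using assms(2) by (simp add: inner_Pair)
  have "w = (if a = 0 then d / b else c / a) *\<^sub>R v"
    using assms(1) eq by (auto simp: zero_prod_def field_simps)
  then show thesis by (rule that)
qed

text \<open>Frechet derivatives make kernel directions independent of coordinates. Degeneracy is
  required in the standard basis only, matching \<open>hessian_det\<close>; \<open>det\<close>
  extends it to all pairs of vectors.\<close>

locale degenerate_hessian =
  fixes u :: "real \<times> real \<Rightarrow> real"
    and u' :: "real \<times> real \<Rightarrow> (real \<times> real) \<Rightarrow>\<^sub>L real"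
    and H :: "real \<times> real \<Rightarrow> (real \<times> real) \<Rightarrow>\<^sub>L (real \<times> real) \<Rightarrow>\<^sub>L real"
  assumes u': "z \<noteq> 0 \<Longrightarrow> (u has_derivative u' z) (at z)"
    and H: "z \<noteq> 0 \<Longrightarrow> (u' has_derivative H z) (at z)"
    and cont_H: "continuous_on (UNIV - {0}) H"
    and det0: "z \<noteq> 0 \<Longrightarrow> H z (1, 0) (1, 0) * H z (0, 1) (0, 1) = (H z (0, 1) (1, 0))\<^sup>2"
begin

lemma H_sym: "z \<noteq> 0 \<Longrightarrow> H z a b = H z b a"
  using u' H cont_H by (intro second_derivative_symmetric[of "UNIV - {0}" z u u']) auto

lemma H_expand:
  "H z a b = fst a * fst b * H z (1, 0) (1, 0) + fst a * snd b * H z (1, 0) (0, 1)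
    + snd a * fst b * H z (0, 1) (1, 0) + snd a * snd b * H z (0, 1) (0, 1)"
proof -
  have "a = fst a *\<^sub>R (1, 0) + snd a *\<^sub>R (0, 1)" "b = fst b *\<^sub>R (1, 0) + snd b *\<^sub>R (0, 1)"
    by (simp_all add: prod_eq_iff)
  then have "H z a b = H z (fst a *\<^sub>R (1, 0) + snd a *\<^sub>R (0, 1)) (fst b *\<^sub>R (1, 0) + snd b *\<^sub>R (0, 1))"
    by simp
  then show ?thesis
    by (simp only: blinfun.bilinear_simps) (simp add: algebra_simps)
qed

text \<open>The Gram determinant of \<open>a\<close> and \<open>b\<close> is the standard
  determinant times the square of the determinant of \<open>a\<close> and \<open>b\<close>.\<close>

lemma det:
  assumes "z \<noteq> 0"
  shows "H z a a * H z b b = (H z b a)\<^sup>2"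
proof -
  define p q r where "p = H z (1, 0) (1, 0)" "q = H z (0, 1) (1, 0)" "r = H z (0, 1) (0, 1)"
  have s: "H z (1, 0) (0, 1) = q" using H_sym[OF assms] by (simp add: p_q_r_def)
  have d: "p * r = q\<^sup>2" using det0[OF assms] by (simp add: p_q_r_def)
  have e: "H z x y = fst x * fst y * p + fst x * snd y * q + snd x * fst y * q + snd x * snd y * r" for x y
    using H_expand[of z x y] s by (simp add: p_q_r_def)
  show ?thesis unfolding e using d by algebra
qed

lemma kernel_exists:
  assumes "z \<noteq> 0"
  obtains v where "v \<noteq> 0" "H z v = 0"
proof -
  define p q r where "p = H z (1, 0) (1, 0)" "q = H z (0, 1) (1, 0)" "r = H z (0, 1) (0, 1)"
  have s: "H z (1, 0) (0, 1) = q" using H_sym[OF assms] by (simp add: p_q_r_def)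
  have d: "p * r = q\<^sup>2" using det0[OF assms] by (simp add: p_q_r_def)
  have e: "H z x y = fst x * fst y * p + fst x * snd y * q + snd x * fst y * q + snd x * snd y * r" for x y
    using H_expand[of z x y] s by (simp add: p_q_r_def)
  show thesis
  proof (cases "p = 0")
    case True
    then have "H z (1, 0) = 0" using d by (intro blinfun_eqI) (simp add: e)
    then show thesis by (intro that[of "(1, 0)"]) (auto simp: zero_prod_def)
  next
    case False
    \<comment> \<open>The vector is perpendicular to the first row \<open>(p, q)\<close> of the
      Hessian matrix; its pairing with the second row is \<open>p * r - q^2\<close>.\<close>
    have "H z (- q, p) = 0"
    proof (rule blinfun_eqI)
      show "H z (- q, p) i = blinfun_apply 0 i" for i
        using d unfolding e by (simp add: algebra_simps power2_eq_square)
    qed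
    then show thesis using False by (intro that[of "(- q, p)"]) (auto simp: zero_prod_def)
  qed
qed

text \<open>Two independent kernel vectors span the plane. This is the source of every contradiction
  from crossing kernel lines.\<close>

lemma H_eq_0I:
  assumes "perp v \<bullet> w \<noteq> 0" "H z v = 0" "H z w = 0"
  shows "H z = 0"
proof (rule blinfun_eqI)
  fix i
  obtain a b c d x y :: real where [simp]: "v = (a, b)" "w = (c, d)" "i = (x, y)" by (metis surj_pair)
  define D where "D = a * d - b * c"
  have "D \<noteq> 0" using assms(1) by (simp add: inner_Pair D_def)
  \<comment> \<open>Cramer's rule in the basis \<open>v\<close>, \<open>w\<close>.\<close>
  have "i = ((x * d - y * c) / D) *\<^sub>R v + ((a * y - b * x) / D) *\<^sub>R w"
    using \<open>D \<noteq> 0\<close> by (simp add: field_simps) (simp add: D_def algebra_simps)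
  then have "H z i = H z (((x * d - y * c) / D) *\<^sub>R v + ((a * y - b * x) / D) *\<^sub>R w)"
    by simp
  also have "\<dots> = 0" using assms(2,3) by (simp only: blinfun.bilinear_simps) simp
  finally show "H z i = blinfun_apply 0 i" by simp
qed

text \<open>By \<open>det\<close>, a degenerate form vanishing at \<open>perp v\<close> annihilates
  \<open>perp v\<close>, so the kernel would be the whole plane. The nonvanishing is the initial
  condition for \<open>local_kernel_line\<close>.\<close>

lemma perp_kernel:
  assumes "z \<noteq> 0" "v \<noteq> 0" "H z v = 0" "H z \<noteq> 0"
  shows "H z (perp v) (perp v) \<noteq> 0"
proof
  assume 0: "H z (perp v) (perp v) = 0"
  have nz: "perp v \<bullet> perp v \<noteq> 0" using \<open>v \<noteq> 0\<close> by (auto simp: prod_eq_iff)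
  have "H z (perp v) = 0"
  proof (rule blinfun_eqI)
    fix i
    have "(H z (perp v) i)\<^sup>2 = 0"
      using det[OF \<open>z \<noteq> 0\<close>, of i "perp v"] 0 by simp
    then show "H z (perp v) i = blinfun_apply 0 i" by simp
  qed
  then show False using H_eq_0I[OF nz \<open>H z v = 0\<close>] \<open>H z \<noteq> 0\<close> by blast
qed

text \<open>The set of parameters near which the reciprocal of the second derivative across the line is a
  fixed affine function is open and closed in \<open>J\<close>; affinity keeps that reciprocal finite, so
  the Hessian cannot degenerate to zero at a limit point.\<close>

lemma kernel_line:
  assumes "z \<noteq> 0" "H z \<noteq> 0" "v \<noteq> 0" "H z v = 0"
    and J: "open J" "connected J" "0 \<in> J" and Jz: "\<And>t. t \<in> J \<Longrightarrow> z + t *\<^sub>R v \<noteq> 0"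
    and "t \<in> J"
  shows "H (z + t *\<^sub>R v) \<noteq> 0" "H (z + t *\<^sub>R v) v = 0"
proof -
  define e where "e = perp v"
  \<comment> \<open>Coordinates in which the line through \<open>z\<close> is the vertical axis. The
    derivatives of \<open>u\<close> along \<open>e\<close> and \<open>v\<close> then play the roles
    of \<open>p\<close> and \<open>q\<close> in \<open>local_kernel_line\<close>.\<close>
  define c where "c = (\<lambda>w. z + fst w *\<^sub>R e + snd w *\<^sub>R v)"
  define S where "S = {w. c w \<noteq> 0}"
  have cont_c: "continuous_on A c" for A unfolding c_def by (intro continuous_intros)
  have "S = c -` (- {0})" by (auto simp: S_def)
  then have "open S" using open_vimage[OF _ cont_c, of "- {0}"] by auto
  have dc: "(c has_derivative (\<lambda>h. fst h *\<^sub>R e + snd h *\<^sub>R v)) (at w)" for w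
    unfolding c_def by (auto intro!: derivative_eq_intros)
  define px py qy where "px = (\<lambda>w. H (c w) e e)" and "py = (\<lambda>w. H (c w) v e)"
    and "qy = (\<lambda>w. H (c w) v v)"
  have cont_Hc: "continuous_on S (\<lambda>w. H (c w))"
    by (rule continuous_on_compose2[OF cont_H cont_c]) (auto simp: S_def)
  have cont: "continuous_on S px" "continuous_on S py"
    unfolding px_def py_def by (intro continuous_intros cont_Hc)+
  have dp: "((\<lambda>w. u' (c w) e) has_derivative (\<lambda>h. px w * fst h + py w * snd h)) (at w)" if "w \<in> S" for w
  proof -
    have "c w \<noteq> 0" using that by (simp add: S_def)
    from has_derivative_compose[OF dc H[OF this]]
    have "((\<lambda>w. u' (c w)) has_derivative (\<lambda>h. H (c w) (fst h *\<^sub>R e + snd h *\<^sub>R v))) (at w)" .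
    from blinfun.FDERIV[OF this has_derivative_const[of e]] show ?thesis
      by (simp add: blinfun.bilinear_simps px_def py_def mult.commute)
  qed
  have dq: "((\<lambda>w. u' (c w) v) has_derivative (\<lambda>h. py w * fst h + qy w * snd h)) (at w)" if "w \<in> S" for w
  proof -
    have "c w \<noteq> 0" using that by (simp add: S_def)
    from has_derivative_compose[OF dc H[OF this]]
    have "((\<lambda>w. u' (c w)) has_derivative (\<lambda>h. H (c w) (fst h *\<^sub>R e + snd h *\<^sub>R v))) (at w)" .
    from blinfun.FDERIV[OF this has_derivative_const[of v]] show ?thesis
      by (simp add: blinfun.bilinear_simps qy_def py_def mult.commute H_sym[OF \<open>c w \<noteq> 0\<close>, of e])
  qed
  have dt: "px w * qy w = (py w)\<^sup>2" if "w \<in> S" for w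
    using det[of "c w" e v] that by (simp add: px_def py_def qy_def S_def)
  have c0: "c (0, t) = z + t *\<^sub>R v" for t by (simp add: c_def)
  have JS: "(0, t) \<in> S" if "t \<in> J" for t using Jz[OF that] by (simp add: S_def c0)
  have local: "\<exists>\<delta>>0. \<exists>a b. \<forall>s. \<bar>s - t\<bar> < \<delta> \<longrightarrow> py (0, s) = 0 \<and> px (0, s) * (a + b * s) = 1"
    if "t \<in> J" "px (0, t) \<noteq> 0" "py (0, t) = 0" for t
    by (rule local_kernel_line[OF \<open>open S\<close> JS[OF that(1)] dp dq cont dt that(2,3)])
  have start: "px (0, 0) \<noteq> 0" "py (0, 0) = 0"
    using perp_kernel[OF assms(1,3,4,2)] assms(4) by (auto simp: px_def py_def c0 e_def)
  obtain \<delta>0 a b where "\<delta>0 > 0"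
    and \<delta>0: "\<And>s. \<bar>s\<bar> < \<delta>0 \<Longrightarrow> py (0, s) = 0 \<and> px (0, s) * (a + b * s) = 1"
    using local[OF J(3) start] by auto
  define E where "E = {s \<in> J. py (0, s) = 0 \<and> px (0, s) * (a + b * s) = 1}"
  \<comment> \<open>Passing to the interior ensures that near a limit point there is a whole
    interval on which the old and the new affine function are both reciprocal to
    \<open>px\<close>.\<close>
  define G where "G = interior E"
  have "0 \<in> G"
    unfolding G_def
  proof (rule interiorI)
    show "J \<inter> ball 0 \<delta>0 \<subseteq> E" using \<delta>0 by (auto simp: E_def)
  qed (use J \<open>\<delta>0 > 0\<close> in auto)
  have closed: "s \<in> G" if "s \<in> J" "s \<in> closure G" for s
  proof -
    obtain x where x: "\<And>n. x n \<in> G" "x \<longlonglongrightarrow> s"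
      using \<open>s \<in> closure G\<close> unfolding closure_sequential by blast
    have xE: "x n \<in> E" for n using x(1) interior_subset unfolding G_def by blast
    have "(\<lambda>n. (0::real, x n)) \<longlonglongrightarrow> (0, s)"
      by (intro tendsto_intros x)
    then have lim: "(\<lambda>n. f (0, x n)) \<longlonglongrightarrow> f (0, s)" if "continuous_on S f" for f :: "real \<times> real \<Rightarrow> real"
      using JS[OF \<open>s \<in> J\<close>] that \<open>open S\<close>
      by (metis continuous_on_eq_continuous_at isCont_tendsto_compose)
    have "(\<lambda>n. py (0, x n)) \<longlonglongrightarrow> py (0, s)" using lim cont by blast
    moreover have "(\<lambda>n. py (0, x n)) = (\<lambda>n. 0)" using xE by (auto simp: E_def)
    ultimately have 1: "py (0, s) = 0" by (simp add: LIMSEQ_const_iff)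
    have "(\<lambda>n. px (0, x n) * (a + b * x n)) \<longlonglongrightarrow> px (0, s) * (a + b * s)"
      using lim cont by (intro tendsto_intros x) blast
    moreover have "(\<lambda>n. px (0, x n) * (a + b * x n)) = (\<lambda>n. 1)" using xE by (auto simp: E_def)
    ultimately have 2: "px (0, s) * (a + b * s) = 1" by (simp add: LIMSEQ_const_iff)
    then have "px (0, s) \<noteq> 0" by auto
    with local[OF \<open>s \<in> J\<close> _ 1] obtain \<delta> a' b' where "\<delta> > 0"
      and \<delta>: "\<And>r. \<bar>r - s\<bar> < \<delta> \<Longrightarrow> py (0, r) = 0 \<and> px (0, r) * (a' + b' * r) = 1"
      by blast
    have agree: "a + b * r = a' + b' * r" if "r \<in> G" "\<bar>r - s\<bar> < \<delta>" for r
    proof -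
      have "px (0, r) * (a + b * r) = 1" using that interior_subset unfolding G_def E_def by blast
      moreover have "px (0, r) * (a' + b' * r) = 1" using \<delta> that by blast
      ultimately show ?thesis by (metis mult_cancel_left zero_neq_one mult_zero_left)
    qed
    \<comment> \<open>Two affine functions that agree at the distinct points \<open>r\<close> and
      \<open>r + \<epsilon> / 2\<close> coincide.\<close>
    have "open (G \<inter> ball s \<delta>)" by (simp add: G_def open_Int)
    moreover obtain r where "r \<in> G \<inter> ball s \<delta>"
      using \<open>s \<in> closure G\<close> \<open>\<delta> > 0\<close> unfolding closure_approachable
      by (auto simp: dist_commute)
    ultimately obtain \<epsilon> where "\<epsilon> > 0" and \<epsilon>: "ball r \<epsilon> \<subseteq> G \<inter> ball s \<delta>"
      using open_contains_ball by blast
    then have "r \<in> ball r \<epsilon>" "r + \<epsilon> / 2 \<in> ball r \<epsilon>" by (auto simp: dist_real_def)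
    then have "r \<in> G \<inter> ball s \<delta>" "r + \<epsilon> / 2 \<in> G \<inter> ball s \<delta>" using \<epsilon> by blast+
    then have eq: "a + b * r = a' + b' * r" "a + b * (r + \<epsilon> / 2) = a' + b' * (r + \<epsilon> / 2)"
      by (auto intro!: agree simp: dist_real_def abs_minus_commute)
    then have "b * (\<epsilon> / 2) = b' * (\<epsilon> / 2)" unfolding distrib_left by linarith
    then have "b = b'" using \<open>\<epsilon> > 0\<close> by simp
    moreover from this have "a = a'" using eq(1) by simp
    ultimately have "J \<inter> ball s \<delta> \<subseteq> E" using \<delta> by (auto simp: E_def dist_real_def abs_minus_commute)
    then show ?thesis
      unfolding G_def using J \<open>s \<in> J\<close> \<open>\<delta> > 0\<close> by (intro interiorI[of "J \<inter> ball s \<delta>"]) auto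
  qed
  \<comment> \<open>\<open>G\<close> and the complement of its closure are disjoint open sets, and
    by \<open>closed\<close> they cover the connected set \<open>J\<close>.\<close>
  have "G \<inter> J = {} \<or> (- closure G) \<inter> J = {}"
    using closed closure_subset[of G] by (intro connectedD[OF J(2)]) (auto simp: G_def)
  then have "t \<in> G" using \<open>0 \<in> G\<close> J(3) closed[OF \<open>t \<in> J\<close>] \<open>t \<in> J\<close> by blast
  then have tE: "py (0, t) = 0" "px (0, t) \<noteq> 0"
    using interior_subset[of E] by (auto simp: G_def E_def)
  then show "H (z + t *\<^sub>R v) \<noteq> 0" by (auto simp: px_def c0)
  show "H (z + t *\<^sub>R v) v = 0"
  proof (rule blinfun_eqI)
    fix i
    have "qy (0, t) = 0" using dt[OF JS[OF \<open>t \<in> J\<close>]] tE by simp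
    then have "(H (z + t *\<^sub>R v) v i)\<^sup>2 = 0"
      using det[OF Jz[OF \<open>t \<in> J\<close>], of i v] by (simp add: qy_def c0)
    then show "H (z + t *\<^sub>R v) v i = blinfun_apply 0 i" by simp
  qed
qed

text \<open>The value of \<open>perp v\<close> is constant along the line and nonzero, so the line
  never meets the origin and \<open>kernel_line\<close> applies to all parameters.\<close>

lemma full_kernel_line:
  assumes "H z \<noteq> 0" "v \<noteq> 0" "H z v = 0" "perp v \<bullet> z \<noteq> 0"
  shows "H (z + t *\<^sub>R v) \<noteq> 0" "H (z + t *\<^sub>R v) v = 0"
proof -
  have "perp v \<bullet> (z + t *\<^sub>R v) = perp v \<bullet> z" for t
    by (simp add: inner_prod_def algebra_simps)
  then have nz: "z + t *\<^sub>R v \<noteq> 0" for t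
    using assms(4) by (metis inner_zero_right)
  from this[of 0] have "z \<noteq> 0" by simp
  then show "H (z + t *\<^sub>R v) \<noteq> 0" "H (z + t *\<^sub>R v) v = 0"
    using kernel_line[of z v UNIV t] assms nz by auto
qed

text \<open>Otherwise the kernel line through \<open>z\<close>, followed only inside the half-plane so that it avoids the
  origin, would meet the kernel line through \<open>z0\<close> transversally.\<close>

lemma kernel_on_half_plane:
  assumes z0: "H z0 \<noteq> 0" "v \<noteq> 0" "H z0 v = 0"
    and side: "(perp v \<bullet> z0) * (perp v \<bullet> z) > 0"
  shows "H z v = 0"
proof (rule ccontr)
  assume contra: "H z v \<noteq> 0"
  let ?n = "perp v"
  have "z \<noteq> 0" using side by auto
  then obtain w where w: "w \<noteq> 0" "H z w = 0" using kernel_exists by blast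
  have nw: "?n \<bullet> w \<noteq> 0"
  proof
    assume "?n \<bullet> w = 0"
    then obtain k where k: "w = k *\<^sub>R v" using perp_orthogonal_imp_parallel[OF \<open>v \<noteq> 0\<close>] by blast
    then have "k \<noteq> 0" using w by auto
    with k w contra show False by (simp add: blinfun.bilinear_simps)
  qed
  \<comment> \<open>Parameters for which the point stays on the side of \<open>z\<close>, written as
    a half-space of the reals so that openness and convexity are immediate.\<close>
  define J where "J = {t. ((?n \<bullet> w) * (?n \<bullet> z)) \<bullet> t > - (?n \<bullet> z)\<^sup>2}"
  have J: "(?n \<bullet> (z + t *\<^sub>R w)) * (?n \<bullet> z) > 0 \<longleftrightarrow> t \<in> J" for t
    by (simp add: J_def inner_add_right algebra_simps power2_eq_square) linarith
  \<comment> \<open>The parameter at which the line through \<open>z\<close> along \<open>w\<close>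
    crosses the line through \<open>z0\<close> along \<open>v\<close>.\<close>
  define t where "t = (?n \<bullet> z0 - ?n \<bullet> z) / (?n \<bullet> w)"
  have nt: "?n \<bullet> (z + t *\<^sub>R w) = ?n \<bullet> z0"
    using nw unfolding t_def inner_add_right inner_scaleR_right by simp
  have "t \<in> J" using J[of t] nt side by simp
  have "0 \<in> J" using J[of 0] side by (auto simp: zero_less_mult_iff)
  have nz: "z + s *\<^sub>R w \<noteq> 0" if "s \<in> J" for s using that J[of s] by force
  have "H z \<noteq> 0" using contra by auto
  have "open J" "connected J"
    unfolding J_def by (rule open_halfspace_gt, rule convex_connected, rule convex_halfspace_gt)
  then have y: "H (z + t *\<^sub>R w) \<noteq> 0" "H (z + t *\<^sub>R w) w = 0"
    using kernel_line[OF \<open>z \<noteq> 0\<close> \<open>H z \<noteq> 0\<close> w _ _ \<open>0 \<in> J\<close> nz \<open>t \<in> J\<close>] by auto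
  have "?n \<bullet> (z + t *\<^sub>R w - z0) = 0" using nt by (simp add: inner_diff_right)
  then obtain k where "z + t *\<^sub>R w - z0 = k *\<^sub>R v"
    using perp_orthogonal_imp_parallel[OF \<open>v \<noteq> 0\<close>] by blast
  then have "z + t *\<^sub>R w = z0 + k *\<^sub>R v" by (simp add: algebra_simps)
  moreover have "?n \<bullet> z0 \<noteq> 0" using side by auto
  ultimately have "H (z + t *\<^sub>R w) v = 0"
    using full_kernel_line[OF z0, of k] by simp
  then show False using H_eq_0I[OF nw] y by blast
qed

text \<open>If the directions differed, the first line could be followed to the level of
  \<open>z1\<close>. There \<open>kernel_on_half_plane\<close> puts \<open>v1\<close> into the
  kernel next to \<open>v0\<close>, although the Hessian is nonzero along the first line.\<close>

lemma kernel_directions_parallel: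
  assumes "H z0 \<noteq> 0" "v0 \<noteq> 0" "H z0 v0 = 0" "perp v0 \<bullet> z0 \<noteq> 0"
    and "H z1 \<noteq> 0" "v1 \<noteq> 0" "H z1 v1 = 0" "perp v1 \<bullet> z1 \<noteq> 0"
  shows "perp v1 \<bullet> v0 = 0"
proof (rule ccontr)
  assume nz: "perp v1 \<bullet> v0 \<noteq> 0"
  define t where "t = (perp v1 \<bullet> z1 - perp v1 \<bullet> z0) / (perp v1 \<bullet> v0)"
  have "perp v1 \<bullet> (z0 + t *\<^sub>R v0) = perp v1 \<bullet> z1"
    using nz unfolding t_def inner_add_right inner_scaleR_right by simp
  then have "(perp v1 \<bullet> z1) * (perp v1 \<bullet> (z0 + t *\<^sub>R v0)) > 0"
    using assms(8) by (metis not_real_square_gt_zero)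
  then have "H (z0 + t *\<^sub>R v0) v1 = 0"
    by (rule kernel_on_half_plane[OF assms(5-7)])
  then show False
    using full_kernel_line[OF assms(1-4), of t] H_eq_0I[OF nz] by blast
qed

end

section \<open>Conical and cylindrical functions\<close>

lemma C2_on_realI:
  fixes f f1 f2 :: "real \<Rightarrow> real"
  assumes "\<And>x. x \<in> S \<Longrightarrow> (f has_real_derivative f1 x) (at x)"
    and "\<And>x. x \<in> S \<Longrightarrow> (f1 has_real_derivative f2 x) (at x)"
    and "continuous_on S f2"
  shows "C2_on f S"
  unfolding C2_on_def
\<comment> \<open>A functional on the reals is multiplication by a number; nesting the embedding
  encodes the second derivative.\<close>
proof (intro exI[of _ "\<lambda>x. blinfun_scaleR_left (f1 x)"]
    exI[of _ "\<lambda>x. blinfun_scaleR_left (blinfun_scaleR_left (f2 x))"] conjI ballI)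
  fix x assume "x \<in> S"
  show "(f has_derivative blinfun_scaleR_left (f1 x)) (at x)"
    using assms(1)[OF \<open>x \<in> S\<close>] by (simp add: has_field_derivative_def mult_commute_abs)
  have "(f1 has_derivative (\<lambda>h. h * f2 x)) (at x)"
    using assms(2)[OF \<open>x \<in> S\<close>] by (simp add: has_field_derivative_def mult_commute_abs)
  from bounded_linear.has_derivative[OF bounded_linear_blinfun_scaleR_left this]
  have "((\<lambda>x. blinfun_scaleR_left (f1 x)) has_derivative (\<lambda>h. blinfun_scaleR_left (h * f2 x))) (at x)" .
  moreover have "(\<lambda>h. blinfun_scaleR_left (h * f2 x)) = blinfun_scaleR_left (blinfun_scaleR_left (f2 x))"
    by (auto intro!: blinfun_eqI simp: blinfun.bilinear_simps)
  ultimately show "((\<lambda>x. blinfun_scaleR_left (f1 x)) has_derivative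
      blinfun_scaleR_left (blinfun_scaleR_left (f2 x))) (at x)"
    by simp
next
  show "continuous_on S (\<lambda>x. blinfun_scaleR_left (blinfun_scaleR_left (f2 x)))"
    by (intro bounded_linear.continuous_on[OF bounded_linear_blinfun_scaleR_left] assms(3))
qed

text \<open>This is the shape of the extension across the origin in
  \<open>removable_of_constant_kernel\<close>. Its second derivative is
  \<open>\<alpha>2 (n \<bullet> x)\<close> times the rank-one form of \<open>n\<close>.\<close>

lemma C2_on_ridge_function:
  fixes n k :: "'a::euclidean_space"
  assumes a1: "\<And>x. (\<alpha> has_real_derivative \<alpha>1 x) (at x)"
    and a2: "\<And>x. (\<alpha>1 has_real_derivative \<alpha>2 x) (at x)"
    and cont: "continuous_on UNIV \<alpha>2"
  shows "C2_on (\<lambda>p. \<alpha> (n \<bullet> p) + k \<bullet> p) UNIV"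
  unfolding C2_on_def
proof (intro exI conjI ballI)
  let ?N = "blinfun_inner_right n"
  fix x :: 'a
  have d: "((\<lambda>p. n \<bullet> p) has_derivative (\<lambda>h. n \<bullet> h)) (at x)"
    by (auto intro!: derivative_eq_intros)
  have "((\<lambda>p. \<alpha> (n \<bullet> p)) has_derivative (\<lambda>h. \<alpha>1 (n \<bullet> x) * (n \<bullet> h))) (at x)"
    using has_derivative_compose[OF d a1[unfolded has_field_derivative_def]] .
  then show "((\<lambda>p. \<alpha> (n \<bullet> p) + k \<bullet> p) has_derivative
      (\<lambda>x. \<alpha>1 (n \<bullet> x) *\<^sub>R ?N + blinfun_inner_right k) x) (at x)"
    by (auto intro!: derivative_eq_intros simp: blinfun.bilinear_simps)
  have "((\<lambda>p. \<alpha>1 (n \<bullet> p)) has_derivative (\<lambda>h. \<alpha>2 (n \<bullet> x) * (n \<bullet> h))) (at x)"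
    using has_derivative_compose[OF d a2[unfolded has_field_derivative_def]] .
  then show "((\<lambda>x. \<alpha>1 (n \<bullet> x) *\<^sub>R ?N + blinfun_inner_right k) has_derivative
      (\<lambda>x. \<alpha>2 (n \<bullet> x) *\<^sub>R (blinfun_scaleR_left ?N o\<^sub>L ?N)) x) (at x)"
    by (auto intro!: derivative_eq_intros simp: blinfun.bilinear_simps)
next
  show "continuous_on UNIV (\<lambda>x. \<alpha>2 (n \<bullet> x) *\<^sub>R (blinfun_scaleR_left (blinfun_inner_right n) o\<^sub>L blinfun_inner_right n))"
    by (intro continuous_intros continuous_on_compose2[OF cont]) auto
qed

text \<open>A point of the hyperplane is approached from outside it along \<open>n\<close>. This
  carries identities from two open half-planes to the dividing line without the origin.\<close>

lemma continuous_zero_off_hyperplane: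
  fixes g :: "'a::euclidean_space \<Rightarrow> 'b::real_normed_vector"
  assumes cont: "continuous_on (UNIV - {0}) g" and "n \<noteq> 0"
    and zero: "\<And>z. n \<bullet> z \<noteq> 0 \<Longrightarrow> g z = 0"
    and "z \<noteq> 0"
  shows "g z = 0"
proof (cases "n \<bullet> z = 0")
  case True
  have "(\<lambda>k. z + inverse (real (Suc k)) *\<^sub>R n) \<longlonglongrightarrow> z + 0 *\<^sub>R n"
    by (intro tendsto_intros LIMSEQ_inverse_real_of_nat)
  then have "(\<lambda>k. g (z + inverse (real (Suc k)) *\<^sub>R n)) \<longlonglongrightarrow> g z"
    using cont \<open>z \<noteq> 0\<close>
    by (intro isCont_tendsto_compose[of _ g]) (auto simp: continuous_on_eq_continuous_at open_delete)
  moreover have "g (z + inverse (real (Suc k)) *\<^sub>R n) = 0" for k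
    using True \<open>n \<noteq> 0\<close> by (intro zero) (simp add: inner_add_right)
  ultimately show ?thesis by (simp add: LIMSEQ_const_iff)
qed (use zero in auto)

lemma orthonormal_expansion:
  assumes "norm v = 1"
  shows "p = (perp v \<bullet> p) *\<^sub>R perp v + (v \<bullet> p) *\<^sub>R v"
proof -
  obtain a b x y :: real where vp: "v = (a, b)" "p = (x, y)" by (metis surj_pair)
  have "a\<^sup>2 + b\<^sup>2 = 1" using assms by (simp add: norm_Pair vp)
  then have "x = (a * y - b * x) * (- b) + (a * x + b * y) * a"
    "y = (a * y - b * x) * a + (a * x + b * y) * b"
    by algebra+
  then show ?thesis by (simp add: vp inner_Pair)
qed

lemma punctured_plane:
  "open (UNIV - {0 :: real \<times> real})" "connected (UNIV - {0 :: real \<times> real})"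
  using connected_punctured_universe[of "0 :: real \<times> real"]
  by (simp_all add: open_delete Compl_eq_Diff_UNIV)

lemma half_plane_eq_sector:
  "{z. (cos \<phi>, sin \<phi>) \<bullet> z < 0} = sector (0, 0) (\<phi> + pi / 2) (\<phi> + 3 * pi / 2)"
proof (intro equalityI subsetI)
  fix z assume z: "z \<in> {z. (cos \<phi>, sin \<phi>) \<bullet> z < 0}"
  \<comment> \<open>\<open>c\<close> and \<open>s\<close> are the coordinates of \<open>z\<close>
    along the axis of the half-plane, which points at angle \<open>\<phi> + pi\<close>, and along
    that axis turned by a right angle. They become \<open>r * cos \<psi>\<close> and
    \<open>r * sin \<psi>\<close>.\<close>
  define c s r where "c = - ((cos \<phi>, sin \<phi>) \<bullet> z)" and "s = (sin \<phi>, - cos \<phi>) \<bullet> z" and "r = norm z"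
  have "c > 0" using z by (simp add: c_def)
  then have "r > 0" by (auto simp: c_def r_def)
  have "c\<^sup>2 + s\<^sup>2 = ((cos \<phi>)\<^sup>2 + (sin \<phi>)\<^sup>2) * ((fst z)\<^sup>2 + (snd z)\<^sup>2)"
    unfolding c_def s_def inner_prod_def fst_conv snd_conv inner_real_def by algebra
  also have "\<dots> = r\<^sup>2" by (simp add: r_def norm_prod_def)
  finally have cs: "c\<^sup>2 + s\<^sup>2 = r\<^sup>2" .
  then have "s\<^sup>2 < r\<^sup>2" using \<open>c > 0\<close> by (smt (verit) zero_less_power)
  then have "\<bar>s\<bar> < r" using \<open>r > 0\<close> by (metis abs_of_pos power2_less_imp_less power2_abs less_imp_le)
  then have b: "- 1 < s / r" "s / r < 1" using \<open>r > 0\<close> by (auto simp: field_simps)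
  define \<psi> where "\<psi> = arcsin (s / r)"
  have \<psi>: "- (pi / 2) < \<psi>" "\<psi> < pi / 2" using arcsin_lt_bounded[OF b] by (auto simp: \<psi>_def)
  have sin\<psi>: "r * sin \<psi> = s" using b \<open>r > 0\<close> by (simp add: \<psi>_def)
  have "(r * cos \<psi>)\<^sup>2 = r\<^sup>2 - (r * sin \<psi>)\<^sup>2"
    by (simp add: power_mult_distrib cos_squared_eq algebra_simps)
  then have "(r * cos \<psi>)\<^sup>2 = c\<^sup>2"
    using cs sin\<psi> by simp
  moreover have "r * cos \<psi> > 0" using \<open>r > 0\<close> cos_gt_zero_pi[OF \<psi>] by simp
  ultimately have cos\<psi>: "r * cos \<psi> = c" using \<open>c > 0\<close> by (simp add: power2_eq_iff_nonneg)
  have "z = (0, 0) + r *\<^sub>R (cos (\<phi> + pi + \<psi>), sin (\<phi> + pi + \<psi>))"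
  proof -
    have "r * cos (\<phi> + pi + \<psi>) = - (cos \<phi> * c) + sin \<phi> * s"
      "r * sin (\<phi> + pi + \<psi>) = - (sin \<phi> * c) - cos \<phi> * s"
      by (simp_all add: cos_add sin_add algebra_simps flip: cos\<psi> sin\<psi>)
    moreover have "- (cos \<phi> * c) + sin \<phi> * s = fst z * ((cos \<phi>)\<^sup>2 + (sin \<phi>)\<^sup>2)"
      "- (sin \<phi> * c) - cos \<phi> * s = snd z * ((cos \<phi>)\<^sup>2 + (sin \<phi>)\<^sup>2)"
      unfolding c_def s_def inner_prod_def fst_conv snd_conv inner_real_def by algebra+
    ultimately show ?thesis by (simp add: prod_eq_iff)
  qed
  then show "z \<in> sector (0, 0) (\<phi> + pi / 2) (\<phi> + 3 * pi / 2)"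
    unfolding sector_def using \<open>r > 0\<close> \<psi>
    by (intro CollectI exI[of _ r] exI[of _ "\<phi> + pi + \<psi>"]) auto
next
  fix z assume "z \<in> sector (0, 0) (\<phi> + pi / 2) (\<phi> + 3 * pi / 2)"
  then obtain r \<theta> where z: "z = (r * cos \<theta>, r * sin \<theta>)" "r > 0"
    and \<theta>: "\<phi> + pi / 2 < \<theta>" "\<theta> < \<phi> + 3 * pi / 2"
    by (auto simp: sector_def)
  have "(cos \<phi>, sin \<phi>) \<bullet> z = - (r * cos (\<theta> - \<phi> - pi))"
    by (simp add: z cos_diff sin_diff inner_Pair algebra_simps)
  moreover have "cos (\<theta> - \<phi> - pi) > 0" using \<theta> by (intro cos_gt_zero_pi) auto
  ultimately show "z \<in> {z. (cos \<phi>, sin \<phi>) \<bullet> z < 0}" using \<open>r > 0\<close> by (simp add: mult_pos_neg)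
qed

section \<open>Functions with radial or constant Hessian kernel\<close>

context degenerate_hessian
begin

lemma u'_apply_derivative:
  assumes "z \<noteq> 0"
  shows "((\<lambda>z. u' z a) has_derivative (\<lambda>h. H z h a)) (at z)"
  using blinfun.FDERIV[OF H[OF assms] has_derivative_const[of a]]
  by (simp add: blinfun.bilinear_simps)

text \<open>Used on the unit circle for the profile of a conical function, and on straight lines,
  where the acceleration \<open>d\<close> is zero, for that of a cylindrical one.\<close>

lemma along_curve:
  assumes "c t \<noteq> 0" "(c has_vector_derivative c' t) (at t)"
  shows "((\<lambda>t. u (c t)) has_real_derivative u' (c t) (c' t)) (at t)"
    and "(c' has_vector_derivative d) (at t) \<Longrightarrow>
      ((\<lambda>t. u' (c t) (c' t)) has_real_derivative H (c t) (c' t) (c' t) + u' (c t) d) (at t)"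
proof -
  show "((\<lambda>t. u (c t)) has_real_derivative u' (c t) (c' t)) (at t)"
    by (rule has_real_derivative_along_curve[OF u'[OF assms(1)] assms(2)])
  have "((\<lambda>t. u' (c t)) has_derivative (\<lambda>h. H (c t) (h *\<^sub>R c' t))) (at t)"
    by (rule has_derivative_compose[OF assms(2)[unfolded has_vector_derivative_def] H[OF assms(1)]])
  moreover assume "(c' has_vector_derivative d) (at t)"
  ultimately have "((\<lambda>t. u' (c t) (c' t)) has_derivative
      (\<lambda>h. u' (c t) (h *\<^sub>R d) + H (c t) (h *\<^sub>R c' t) (c' t))) (at t)"
    unfolding has_vector_derivative_def by (rule blinfun.FDERIV)
  then show "((\<lambda>t. u' (c t) (c' t)) has_real_derivative H (c t) (c' t) (c' t) + u' (c t) d) (at t)"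
    by (rule has_derivative_imp_has_field_derivative) (simp add: blinfun.bilinear_simps algebra_simps)
qed

lemma continuous_u': "continuous_on (UNIV - {0}) u'"
  using H by (auto intro!: continuous_at_imp_continuous_on has_derivative_continuous)

lemma curve_second_derivative_continuous:
  assumes "\<And>t. t \<in> T \<Longrightarrow> c t \<noteq> 0" "continuous_on T c" "continuous_on T c'" "continuous_on T c''"
  shows "continuous_on T (\<lambda>t. H (c t) (c' t) (c' t) + u' (c t) (c'' t))"
  using assms
  by (intro continuous_intros continuous_on_compose2[OF cont_H] continuous_on_compose2[OF continuous_u']) auto

lemma C2_on_circle:
  assumes "\<And>\<theta>. \<theta> \<in> T \<Longrightarrow> (cos \<theta>, sin \<theta>) \<noteq> 0"
  shows "C2_on (\<lambda>\<theta>. u (cos \<theta>, sin \<theta>) - d) T"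
proof (rule C2_on_realI)
  let ?c = "\<lambda>\<theta>::real. (cos \<theta>, sin \<theta>)" and ?c1 = "\<lambda>\<theta>::real. (- sin \<theta>, cos \<theta>)"
    and ?c2 = "\<lambda>\<theta>::real. (- cos \<theta>, - sin \<theta>)"
  have c: "(?c has_vector_derivative ?c1 t) (at t)" "(?c1 has_vector_derivative ?c2 t) (at t)" for t
    unfolding has_vector_derivative_def by (auto intro!: derivative_eq_intros)
  show "((\<lambda>\<theta>. u (?c \<theta>) - d) has_real_derivative u' (?c t) (?c1 t)) (at t)" if "t \<in> T" for t
    using DERIV_diff[OF along_curve(1)[where c="?c" and c'="?c1" and t=t, OF assms[OF that] c(1)] DERIV_const[of d]] by simp
  show "((\<lambda>t. u' (?c t) (?c1 t)) has_real_derivative H (?c t) (?c1 t) (?c1 t) + u' (?c t) (?c2 t)) (at t)"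
    if "t \<in> T" for t
    by (rule along_curve(2)[where c="?c" and c'="?c1" and t=t, OF assms[OF that] c])
  show "continuous_on T (\<lambda>t. H (?c t) (?c1 t) (?c1 t) + u' (?c t) (?c2 t))"
    by (rule curve_second_derivative_continuous[OF assms]) (auto intro!: continuous_intros)
qed

text \<open>The derivative of \<open>u z - u' z z\<close> in direction \<open>h\<close> is
  \<open>- H z h z\<close>, zero by symmetry and the radial kernel. The constant value of this
  expression is the \<open>u0\<close> of the cone.\<close>

lemma radially_affine:
  assumes S: "open S" "connected S" "0 \<notin> S" "S \<noteq> {}"
    and cone: "\<And>z \<rho>. z \<in> S \<Longrightarrow> \<rho> > 0 \<Longrightarrow> \<rho> *\<^sub>R z \<in> S"
    and rad: "\<And>z. z \<in> S \<Longrightarrow> H z z = 0"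
  obtains u0 where "\<And>z \<rho>. z \<in> S \<Longrightarrow> \<rho> > 0 \<Longrightarrow> u (\<rho> *\<^sub>R z) = u0 + \<rho> * (u z - u0)"
proof -
  obtain z0 where "z0 \<in> S" using S by blast
  define u0 where "u0 = u z0 - u' z0 z0"
  have legendre: "u z - u' z z = u0" if "z \<in> S" for z
    unfolding u0_def
  proof (rule has_derivative_zero_unique_connected[OF S(1,2) _ that \<open>z0 \<in> S\<close>, where f="\<lambda>z. u z - u' z z"])
    fix x assume "x \<in> S"
    then have "x \<noteq> 0" using S by auto
    have "((\<lambda>z. u z - u' z z) has_derivative (\<lambda>h. u' x h - (u' x h + H x h x))) (at x)"
      by (intro has_derivative_diff u' blinfun.FDERIV H \<open>x \<noteq> 0\<close> has_derivative_ident)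
    then show "((\<lambda>z. u z - u' z z) has_derivative (\<lambda>h. 0)) (at x)"
      using rad[OF \<open>x \<in> S\<close>] H_sym[OF \<open>x \<noteq> 0\<close>, of _ x] by simp
  qed
  have "u (\<rho> *\<^sub>R z) = u0 + \<rho> * (u z - u0)" if "z \<in> S" "\<rho> > 0" for z \<rho>
  proof -
    \<comment> \<open>The radial slope is constant on each ray. With \<open>legendre\<close> at both
      \<open>z\<close> and its multiple by \<open>\<rho>\<close>, this gives the affine
      formula.\<close>
    have "u' (\<rho> *\<^sub>R z) z = u' (1 *\<^sub>R z) z"
    proof (rule has_derivative_zero_unique_connected[of "{0<..}" "\<lambda>\<rho>. u' (\<rho> *\<^sub>R z) z"])
      fix r :: real assume "r \<in> {0<..}"
      then have "r > 0" by simp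
      have rz: "r *\<^sub>R z \<in> S" using cone that \<open>r > 0\<close> by blast
      then have "r *\<^sub>R z \<noteq> 0" using S by auto
      have "((\<lambda>\<rho>. u' (\<rho> *\<^sub>R z) z) has_derivative (\<lambda>h. H (r *\<^sub>R z) (h *\<^sub>R z) z)) (at r)"
        by (rule has_derivative_compose[where f="\<lambda>\<rho>. \<rho> *\<^sub>R z", OF _ u'_apply_derivative[OF \<open>r *\<^sub>R z \<noteq> 0\<close>]])
          (auto intro!: derivative_eq_intros)
      moreover have "H (r *\<^sub>R z) z = 0"
        using rad[OF rz] \<open>r > 0\<close> by (simp add: blinfun.bilinear_simps)
      ultimately show "((\<lambda>\<rho>. u' (\<rho> *\<^sub>R z) z) has_derivative (\<lambda>h. 0)) (at r)"
        by (simp add: blinfun.bilinear_simps)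
    qed (use that in auto)
    then show ?thesis
      using legendre[OF \<open>z \<in> S\<close>] legendre[OF cone[OF that]] by (simp add: blinfun.bilinear_simps algebra_simps)
  qed
  then show thesis by (rule that)
qed

lemma conical_on_punctured_plane:
  assumes "\<And>z. z \<noteq> 0 \<Longrightarrow> H z z = 0"
  shows "conical_on u (0, 0) (UNIV - {(0, 0)})"
proof -
  have "(1, 1) \<in> UNIV - {0 :: real \<times> real}" by (simp add: zero_prod_def)
  then obtain u0 where u0: "\<And>z \<rho>. z \<in> UNIV - {0} \<Longrightarrow> \<rho> > 0 \<Longrightarrow> u (\<rho> *\<^sub>R z) = u0 + \<rho> * (u z - u0)"
    using radially_affine[OF punctured_plane] assms by (metis Diff_iff UNIV_I emptyE insertCI scaleR_eq_0_iff
        singletonD less_irrefl)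
  have nz: "(cos \<theta>, sin \<theta>) \<noteq> 0" for \<theta> :: real
    using sin_zero_abs_cos_one[of \<theta>] by (auto simp: zero_prod_def)
  show ?thesis
    unfolding conical_on_def
    using u0[of "(cos _, sin _)"] nz
    by (intro disjI2 conjI refl exI[of _ u0] exI[of _ "\<lambda>\<theta>. u (cos \<theta>, sin \<theta>) - u0"] C2_on_circle) auto
qed

lemma conical_on_half_plane:
  assumes "norm n = 1" "\<And>z. n \<bullet> z < 0 \<Longrightarrow> H z z = 0"
  shows "conical_on u (0, 0) {z. n \<bullet> z < 0}"
proof -
  have "(fst n)\<^sup>2 + (snd n)\<^sup>2 = 1" using assms(1) by (simp add: norm_prod_def)
  then obtain \<phi> where \<phi>: "n = (cos \<phi>, sin \<phi>)" using sincos_total_2pi by (metis prod.collapse)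
  let ?S = "{z. n \<bullet> z < 0}"
  have "- n \<in> ?S" using assms(1) by (simp add: norm_eq_1)
  then have ne: "?S \<noteq> {}" by blast
  have S: "open ?S" "connected ?S" "0 \<notin> ?S"
    by (simp_all add: open_halfspace_lt convex_connected convex_halfspace_lt)
  obtain u0 where u0: "\<And>z \<rho>. z \<in> ?S \<Longrightarrow> \<rho> > 0 \<Longrightarrow> u (\<rho> *\<^sub>R z) = u0 + \<rho> * (u z - u0)"
    by (rule radially_affine[OF S ne]) (use assms(2) in \<open>auto simp: mult_pos_neg\<close>)
  have sector: "?S = sector (0, 0) (\<phi> + pi / 2) (\<phi> + 3 * pi / 2)"
    unfolding \<phi> by (rule half_plane_eq_sector)
  have inS: "(cos \<theta>, sin \<theta>) \<in> ?S" if "\<theta> \<in> {\<phi> + pi / 2 <..< \<phi> + 3 * pi / 2}" for \<theta>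
    unfolding sector sector_def using that by (intro CollectI exI[of _ 1] exI[of _ \<theta>]) auto
  then have nz: "(cos \<theta>, sin \<theta>) \<noteq> 0" if "\<theta> \<in> {\<phi> + pi / 2 <..< \<phi> + 3 * pi / 2}" for \<theta>
    using that by fastforce
  show ?thesis
    unfolding conical_on_def
    using u0[OF inS] sector
    by (intro disjI1 exI[of _ "\<phi> + pi / 2"] exI[of _ "\<phi> + 3 * pi / 2"] exI[of _ u0]
        exI[of _ "\<lambda>\<theta>. u (cos \<theta>, sin \<theta>) - u0"] conjI C2_on_circle nz) auto
qed

text \<open>The derivative of \<open>u' z v\<close> in direction \<open>h\<close> is
  \<open>H z h v\<close>, which by symmetry is \<open>H z v h = 0\<close>.\<close>

lemma constant_slope:
  assumes S: "open S" "connected S" "0 \<notin> S"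
    and ker: "\<And>z. z \<in> S \<Longrightarrow> H z v = 0"
  obtains v0 where "\<And>z. z \<in> S \<Longrightarrow> u' z v = v0"
proof -
  have "u' x v = u' y v" if "x \<in> S" "y \<in> S" for x y
  proof (rule has_derivative_zero_unique_connected[OF S(1,2) _ that, where f="\<lambda>z. u' z v"])
    fix z assume "z \<in> S"
    then have "z \<noteq> 0" using S by auto
    have "H z h v = 0" for h using H_sym[OF \<open>z \<noteq> 0\<close>, of h v] ker[OF \<open>z \<in> S\<close>] by simp
    then show "((\<lambda>z. u' z v) has_derivative (\<lambda>h. 0)) (at z)"
      using u'_apply_derivative[OF \<open>z \<noteq> 0\<close>, of v] by simp
  qed
  then show thesis using that by metis
qed

lemma affine_along_line:
  assumes "\<And>t. z + t *\<^sub>R v \<noteq> 0" "\<And>t. u' (z + t *\<^sub>R v) v = v0"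
  shows "u (z + t *\<^sub>R v) - v0 * t = u (z + s *\<^sub>R v) - v0 * s"
proof (rule has_derivative_zero_unique_connected[of UNIV "\<lambda>t. u (z + t *\<^sub>R v) - v0 * t"])
  fix t :: real
  have "((\<lambda>t. u (z + t *\<^sub>R v)) has_real_derivative u' (z + t *\<^sub>R v) v) (at t)"
    by (rule along_curve(1)[where c'="\<lambda>_. v" and c="\<lambda>t. z + t *\<^sub>R v", OF assms(1)]) (auto intro!: derivative_eq_intros)
  from DERIV_diff[OF this DERIV_cmult_Id[of v0]]
  show "((\<lambda>t. u (z + t *\<^sub>R v) - v0 * t) has_derivative (\<lambda>h. 0)) (at t)"
    by (simp add: assms(2) has_field_derivative_def lambda_zero)
qed auto

lemma line_derivatives:
  assumes "\<And>x. x \<in> I \<Longrightarrow> x *\<^sub>R n + w \<noteq> 0"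
  shows "\<And>x. x \<in> I \<Longrightarrow> ((\<lambda>x. u (x *\<^sub>R n + w)) has_real_derivative u' (x *\<^sub>R n + w) n) (at x)"
    and "\<And>x. x \<in> I \<Longrightarrow> ((\<lambda>x. u' (x *\<^sub>R n + w) n) has_real_derivative H (x *\<^sub>R n + w) n n) (at x)"
    and "continuous_on I (\<lambda>x. H (x *\<^sub>R n + w) n n)"
proof -
  have c: "((\<lambda>x. x *\<^sub>R n + w) has_vector_derivative n) (at x)" for x
    by (auto intro!: derivative_eq_intros)
  show "((\<lambda>x. u (x *\<^sub>R n + w)) has_real_derivative u' (x *\<^sub>R n + w) n) (at x)" if "x \<in> I" for x
    using along_curve(1)[where c="\<lambda>x. x *\<^sub>R n + w" and c'="\<lambda>_. n", OF assms[OF that] c] .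
  show "((\<lambda>x. u' (x *\<^sub>R n + w) n) has_real_derivative H (x *\<^sub>R n + w) n n) (at x)" if "x \<in> I" for x
    using along_curve(2)[where c="\<lambda>x. x *\<^sub>R n + w" and c'="\<lambda>_. n" and d=0 and t=x, OF assms[OF that] c]
    by (simp add: blinfun.bilinear_simps)
  show "continuous_on I (\<lambda>x. H (x *\<^sub>R n + w) n n)"
    using curve_second_derivative_continuous[where c="\<lambda>x. x *\<^sub>R n + w" and c'="\<lambda>_. n" and c''="\<lambda>_. 0" and T=I] assms
    by (simp add: blinfun.bilinear_simps continuous_intros)
qed

text \<open>All lines parallel to \<open>v\<close> in the half-plane carry affine functions of one
  common slope \<open>v0\<close>; the profile is the restriction of \<open>u\<close> to the
  perpendicular axis.\<close>

lemma cylindrical_on_half_plane: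
  assumes v: "norm v = 1" and ker: "\<And>z. perp v \<bullet> z > 0 \<Longrightarrow> H z v = 0"
  shows "cylindrical_on u {z. perp v \<bullet> z > 0}"
proof -
  let ?n = "perp v" and ?S = "{z. perp v \<bullet> z > 0}"
  have ortho: "?n \<bullet> v = 0" by (simp add: inner_prod_def)
  have n1: "norm ?n = 1" using v by (simp add: norm_prod_def add.commute)
  then have nn: "?n \<bullet> ?n = 1" by (simp add: norm_eq_1)
  have S: "open ?S" "connected ?S" "0 \<notin> ?S"
    by (auto simp: open_halfspace_gt intro!: convex_connected convex_halfspace_gt)
  then obtain v0 where v0: "\<And>z. z \<in> ?S \<Longrightarrow> u' z v = v0"
    using constant_slope[of ?S v] ker by auto
  have inS: "x *\<^sub>R ?n + y *\<^sub>R v \<in> ?S \<longleftrightarrow> x > 0" for x y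
    using nn ortho by (simp only: mem_Collect_eq inner_add_right inner_scaleR_right) simp
  have strip: "?S = strip ?n v {0<..}"
  proof (intro equalityI subsetI)
    fix p assume "p \<in> ?S"
    then show "p \<in> strip ?n v {0<..}"
      unfolding strip_def using orthonormal_expansion[OF v, of p] by blast
  next
    fix p assume "p \<in> strip ?n v {0<..}"
    then obtain x y where "p = x *\<^sub>R ?n + y *\<^sub>R v" "x > 0" unfolding strip_def by blast
    then show "p \<in> ?S" using inS by metis
  qed
  have nz: "x *\<^sub>R ?n + y *\<^sub>R v \<noteq> 0" if "x > 0" for x y
    using inS[of x y] that S(3) by metis
  have nz0: "x *\<^sub>R ?n + 0 \<noteq> 0" if "x \<in> {0<..}" for x
    using nz[of x 0] that unfolding scaleR_zero_left greaterThan_iff by blast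
  have "u (x *\<^sub>R ?n + y *\<^sub>R v) = u (x *\<^sub>R ?n + 0) + v0 * y" if "x \<in> {0<..}" for x y
    using affine_along_line[of "x *\<^sub>R ?n" v v0 y 0] that nz v0[of "x *\<^sub>R ?n + _ *\<^sub>R v"] inS by simp
  moreover have "C2_on (\<lambda>x. u (x *\<^sub>R ?n + 0)) {0<..}"
    by (rule C2_on_realI[OF line_derivatives[OF nz0]])
  ultimately show ?thesis
    unfolding cylindrical_on_def
    using n1 v ortho strip
    by (intro exI[of _ ?n] exI[of _ v] exI[of _ "{0<..}"] exI[of _ "\<lambda>x. u (x *\<^sub>R ?n + 0)"] exI[of _ v0]) auto
qed

text \<open>The perpendicular axis itself meets the origin, so the profile is read off its translate
  by \<open>v\<close>, where \<open>u\<close> is regular throughout. The resulting cylindrical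
  formula makes sense on the whole plane.\<close>

lemma removable_of_constant_kernel:
  assumes v: "norm v = 1" and ker: "\<And>z. z \<noteq> 0 \<Longrightarrow> H z v = 0"
  shows "\<exists>V. C2_on V UNIV \<and> (\<forall>p. p \<noteq> 0 \<longrightarrow> V p = u p)"
proof -
  let ?n = "perp v"
  have ortho: "?n \<bullet> v = 0" by (simp add: inner_prod_def)
  have nn: "?n \<bullet> ?n = 1" using v by (simp add: norm_prod_def inner_prod_def power2_eq_square add.commute)
  obtain v0 where v0: "\<And>z. z \<noteq> 0 \<Longrightarrow> u' z v = v0"
    using constant_slope[OF punctured_plane, of v] ker by auto
  have coords: "?n \<bullet> (x *\<^sub>R ?n + y *\<^sub>R v) = x" "v \<bullet> (x *\<^sub>R ?n + y *\<^sub>R v) = y" for x y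
    using nn ortho v by (simp_all only: inner_add_right inner_scaleR_right inner_commute[of v ?n] norm_eq_1)
  have nz: "x *\<^sub>R ?n + v \<noteq> 0" for x
    using coords(2)[of x 1] by auto
  \<comment> \<open>Points of the shifted axis have \<open>v\<close>-coordinate 1, hence the
    correction \<open>- v0\<close>.\<close>
  define V where "V = (\<lambda>p. u ((?n \<bullet> p) *\<^sub>R ?n + v) - v0 + (v0 *\<^sub>R v) \<bullet> p)"
  have d: "\<And>x. ((\<lambda>x. u (x *\<^sub>R ?n + v) - v0) has_real_derivative u' (x *\<^sub>R ?n + v) ?n) (at x)"
    using DERIV_diff[OF line_derivatives(1)[where I=UNIV and w=v and n="?n", OF nz UNIV_I] DERIV_const[of v0]] by simp
  have C2: "C2_on V UNIV"
    unfolding V_def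
    by (rule C2_on_ridge_function[OF d line_derivatives(2,3)[where I=UNIV and w=v and n="?n", OF nz]]) auto
  \<comment> \<open>The lines along \<open>v\<close> that miss the origin come first. On the
    remaining one affinity cannot be carried across the origin, so continuity settles it
    afterwards.\<close>
  have gen: "V p - u p = 0" if "?n \<bullet> p \<noteq> 0" for p
  proof -
    let ?x = "?n \<bullet> p" and ?y = "v \<bullet> p"
    have p: "p = ?x *\<^sub>R ?n + ?y *\<^sub>R v" using orthonormal_expansion[OF v] .
    have nz': "?x *\<^sub>R ?n + t *\<^sub>R v \<noteq> 0" for t
      using that coords(1)[of ?x t] by (metis inner_zero_right)
    have "u (?x *\<^sub>R ?n + ?y *\<^sub>R v) - v0 * ?y = u (?x *\<^sub>R ?n + 1 *\<^sub>R v) - v0 * 1"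
      by (rule affine_along_line[OF nz' v0[OF nz']])
    then show ?thesis using p by (simp add: V_def)
  qed
  have "continuous_on (UNIV - {0}) u"
    using u' by (auto intro!: continuous_at_imp_continuous_on has_derivative_continuous)
  moreover have "continuous_on A V" for A
  proof -
    obtain V' where "\<forall>x. (V has_derivative blinfun_apply (V' x)) (at x)"
      using C2 unfolding C2_on_def by auto
    then show ?thesis by (metis continuous_at_imp_continuous_on has_derivative_continuous)
  qed
  ultimately have "continuous_on (UNIV - {0}) (\<lambda>p. V p - u p)"
    by (intro continuous_intros)
  moreover have "?n \<noteq> 0" using nn by force
  ultimately have "V p - u p = 0" if "p \<noteq> 0" for p
    using continuous_zero_off_hyperplane[of "\<lambda>p. V p - u p" ?n] gen that by blast
  then show ?thesis using C2 by auto
qed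

section \<open>Combining the two half-planes\<close>

lemma dichotomy:
  assumes sing: "\<not> (\<exists>V. C2_on V UNIV \<and> (\<forall>p. p \<noteq> 0 \<longrightarrow> V p = u p))"
  shows "conical_on u (0, 0) (UNIV - {(0, 0)}) \<or>
    (\<exists>n. n \<noteq> 0 \<and> cylindrical_on u {z. n \<bullet> z > 0} \<and> conical_on u (0, 0) {z. n \<bullet> z < 0})"
proof (cases "\<forall>z. z \<noteq> 0 \<longrightarrow> H z z = 0")
  case True
  then show ?thesis using conical_on_punctured_plane by blast
next
  case False
  have transversal: "\<exists>v. v \<noteq> 0 \<and> H z v = 0 \<and> perp v \<bullet> z \<noteq> 0" if "z \<noteq> 0" "H z z \<noteq> 0" for z
  proof -
    obtain v where v: "v \<noteq> 0" "H z v = 0" using kernel_exists[OF \<open>z \<noteq> 0\<close>] .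
    have "perp v \<bullet> z \<noteq> 0"
    proof
      assume "perp v \<bullet> z = 0"
      then obtain k where "z = k *\<^sub>R v" using perp_orthogonal_imp_parallel[OF v(1)] by blast
      then have "H z z = k *\<^sub>R H z v" by (metis blinfun.scaleR_right)
      then show False using v that by simp
    qed
    with v show ?thesis by blast
  qed
  from False obtain z0 where z0: "z0 \<noteq> 0" "H z0 z0 \<noteq> 0" by blast
  then have Hz0: "H z0 \<noteq> 0" by auto
  obtain w where w: "w \<noteq> 0" "H z0 w = 0" "perp w \<bullet> z0 \<noteq> 0" using transversal[OF z0] by blast
  \<comment> \<open>Normalised and oriented so that \<open>z0\<close> lies on the positive side of
    the line through the origin along \<open>v\<close>.\<close>
  define v where "v = (sgn (perp w \<bullet> z0) / norm w) *\<^sub>R w"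
  have v: "norm v = 1" "H z0 v = 0"
    using w by (simp_all add: v_def blinfun.bilinear_simps abs_sgn_eq)
  have "perp (k *\<^sub>R w) \<bullet> z0 = k * (perp w \<bullet> z0)" for k
    by (simp add: inner_prod_def algebra_simps)
  then have "perp v \<bullet> z0 = sgn (perp w \<bullet> z0) / norm w * (perp w \<bullet> z0)"
    unfolding v_def .
  also have "\<dots> = \<bar>perp w \<bullet> z0\<bar> / norm w" by (simp add: abs_sgn mult.commute)
  finally have vz0: "perp v \<bullet> z0 > 0" using w by simp
  have "v \<noteq> 0" using v by auto
  have A: "H z v = 0" if "perp v \<bullet> z > 0" for z
    using that vz0 by (intro kernel_on_half_plane[OF Hz0 \<open>v \<noteq> 0\<close> v(2)]) simp
  have cyl: "cylindrical_on u {z. perp v \<bullet> z > 0}"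
    using cylindrical_on_half_plane[OF v(1)] A by blast
  \<comment> \<open>A nonradial kernel line on the negative side would be parallel to
    \<open>v\<close>. Then \<open>v\<close> lies in the kernel on both sides, by continuity at every
    point but the origin, and the singularity would be removable.\<close>
  have "H z z = 0" if B: "perp v \<bullet> z < 0" for z
  proof (rule ccontr)
    assume Hz: "H z z \<noteq> 0"
    then have "H z \<noteq> 0" "z \<noteq> 0" using B by auto
    obtain v1 where v1: "v1 \<noteq> 0" "H z v1 = 0" "perp v1 \<bullet> z \<noteq> 0"
      using transversal[OF \<open>z \<noteq> 0\<close> Hz] by blast
    have "perp v1 \<bullet> v = 0"
      using vz0 kernel_directions_parallel[OF Hz0 \<open>v \<noteq> 0\<close> v(2) _ \<open>H z \<noteq> 0\<close> v1] by simp
    then obtain k where "v = k *\<^sub>R v1" using perp_orthogonal_imp_parallel[OF v1(1)] by blast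
    then have "H z v = 0" using v1 by (simp add: blinfun.bilinear_simps)
    have "H y v = 0" if "perp v \<bullet> y < 0" for y
      using that B by (intro kernel_on_half_plane[OF \<open>H z \<noteq> 0\<close> \<open>v \<noteq> 0\<close> \<open>H z v = 0\<close>]) (simp add: mult_neg_neg)
    with A have off: "H y v = 0" if "perp v \<bullet> y \<noteq> 0" for y
      using that by (meson linorder_neqE)
    have "continuous_on (UNIV - {0}) (\<lambda>y. H y v)" by (intro continuous_intros cont_H)
    moreover have "perp v \<noteq> 0" using \<open>v \<noteq> 0\<close> by (auto simp: prod_eq_iff)
    ultimately have "H y v = 0" if "y \<noteq> 0" for y
      using continuous_zero_off_hyperplane[of "\<lambda>y. H y v" "perp v"] off that by blast
    then show False using removable_of_constant_kernel[OF v(1)] sing by blast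
  qed
  moreover have "norm (perp v) = 1" using v by (simp add: norm_prod_def add.commute)
  ultimately have "conical_on u (0, 0) {z. perp v \<bullet> z < 0}"
    by (rule conical_on_half_plane[rotated])
  moreover have "perp v \<noteq> 0" using \<open>v \<noteq> 0\<close> by (auto simp: prod_eq_iff)
  ultimately show ?thesis using cyl by blast
qed

end

lemma partial_deriv_eq:
  assumes "(f has_derivative f') (at p)"
  shows "partial_deriv b f p = f' b"
proof -
  have "((\<lambda>t. f (p + t *\<^sub>R b)) has_real_derivative f' b) (at 0)"
    using assms by (intro has_real_derivative_along_curve) (auto intro!: derivative_eq_intros)
  then show ?thesis unfolding partial_deriv_def by (rule DERIV_imp_deriv)
qed

theorem theorem2:
  fixes u :: "real \<times> real \<Rightarrow> real"
  assumes "C2_on u (UNIV - {(0, 0)})"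
    and "\<And>p. p \<noteq> (0, 0) \<Longrightarrow> hessian_det u p = 0"
    and "isolated_singularity_at_origin u"
  shows "conical_on u (0, 0) (UNIV - {(0, 0)}) \<or>
    (\<exists>r A B. is_line r \<and> (0, 0) \<in> r \<and> open_half_planes r A B \<and>
      cylindrical_on u A \<and> conical_on u (0, 0) B)"
proof -
  have zero: "(0, 0) = (0 :: real \<times> real)" by (simp add: zero_prod_def)
  obtain u' H where u': "\<And>z. z \<noteq> 0 \<Longrightarrow> (u has_derivative blinfun_apply (u' z)) (at z)"
    and H: "\<And>z. z \<noteq> 0 \<Longrightarrow> (u' has_derivative blinfun_apply (H z)) (at z)"
    and cont: "continuous_on (UNIV - {0}) H"
    using assms(1) unfolding C2_on_def zero by (metis DiffI UNIV_I singletonD)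
  \<comment> \<open>The first partial derivative is known to equal \<open>u' z a\<close> only off
    the origin, which suffices because that set is open.\<close>
  have second: "partial_deriv b (partial_deriv a u) z = H z b a" if "z \<noteq> 0" for a b z
  proof (rule partial_deriv_eq)
    have "((\<lambda>z. u' z a) has_derivative (\<lambda>h. H z h a)) (at z)"
      using blinfun.FDERIV[OF H[OF that] has_derivative_const[of a]]
      by (simp add: blinfun.bilinear_simps)
    then show "(partial_deriv a u has_derivative (\<lambda>h. H z h a)) (at z)"
      by (rule has_derivative_transform_within_open[of _ _ _ _ "UNIV - {0}"])
        (use that partial_deriv_eq[OF u'] in \<open>auto simp: open_delete\<close>)
  qed
  interpret degenerate_hessian u u' H
  proof
    show "H z (1, 0) (1, 0) * H z (0, 1) (0, 1) = (H z (0, 1) (1, 0))\<^sup>2" if "z \<noteq> 0" for z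
      using assms(2)[of z] that by (simp add: hessian_det_def second zero)
  qed (use u' H cont in auto)
  have "\<not> (\<exists>V. C2_on V UNIV \<and> (\<forall>p. p \<noteq> 0 \<longrightarrow> V p = u p))"
    using assms(3) unfolding isolated_singularity_at_origin_def zero .
  from dichotomy[OF this] show ?thesis
  proof (elim disjE exE conjE)
    fix n :: "real \<times> real"
    assume n: "n \<noteq> 0" "cylindrical_on u {z. n \<bullet> z > 0}" "conical_on u (0, 0) {z. n \<bullet> z < 0}"
    have "is_line {p. n \<bullet> p = 0}"
      unfolding is_line_def using aff_dim_hyperplane[OF n(1), of 0] by (simp add: affine_hyperplane)
    moreover have "open_half_planes {p. n \<bullet> p = 0} {z. n \<bullet> z > 0} {z. n \<bullet> z < 0}"
      unfolding open_half_planes_def using n(1) by blast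
    moreover have "(0, 0) \<in> {p. n \<bullet> p = 0}" by (simp add: zero)
    ultimately show ?thesis using n by blast
  qed auto
qed

end
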